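(* There exists a sequence of maximal gaps $(\alpha_n,\beta_n)$, $n\in\mathbb{N}$, of the Markov spectrum $M$ (i.e. bounded connected components of $\mathbb{R}\setminus M$) such that $\lim_{n\to\infty}\beta_n=\nu$, where $$\nu=[4;3,1,3,1,3,\overline{4,4,4,3,2,3}]+[0;3,1,3,1,2,1,1,3,3,\overline{3,1,3,1,2,1}]=4.52782953841\ldots.$$
   Context: For a bi-infinite sequence $\underline{a}=(a_i)_{i\in\mathbb{Z}}\in\{1,2,3,\dots\}^{\mathbb{Z}}$ and $j\in\mathbb{Z}$, let $\lambda_j(\underline{a})=[a_j;a_{j-1},a_{j-2},\dots]+[0;a_{j+1},a_{j+2},\dots]$ (continued fractions), and $m(\underline{a})=\sup_{j\in\mathbb{Z}}\lambda_j(\underline{a})$. The Markov spectrum is $M=\{m(\underline{a}):\underline{a}\in\{1,2,3,\dots\}^{\mathbb{Z}}\}$. In continued fractions an overline denotes infinite periodic repetition of the overlined block of partial quotients. *)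

theory Defs
  imports "HOL-Analysis.Analysis"
begin

primrec cfrac_conv :: "nat \<Rightarrow> (nat \<Rightarrow> nat) \<Rightarrow> real" where
  "cfrac_conv 0 a = real (a 0)"
| "cfrac_conv (Suc n) a = real (a 0) + 1 / cfrac_conv n (\<lambda>i. a (Suc i))"

text \<open>The limit exists whenever \<open>a i \<ge> 1\<close> for all \<open>i \<ge> 1\<close>; the integer part
  \<open>a 0\<close> may be \<open>0\<close>.\<close>

definition cfrac :: "(nat \<Rightarrow> nat) \<Rightarrow> real" where
  "cfrac a = lim (\<lambda>n. cfrac_conv n a)"

definition markov_lambda :: "(int \<Rightarrow> nat) \<Rightarrow> int \<Rightarrow> real" where
  "markov_lambda a j =
     cfrac (\<lambda>i. a (j - int i)) + cfrac (case_nat 0 (\<lambda>i. a (j + 1 + int i)))"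

text \<open>Extended-real valued: the supremum is \<open>\<infinity>\<close> for unbounded sequences, which therefore
  contribute no point to the Markov spectrum as a set of real numbers.\<close>

definition markov_sup :: "(int \<Rightarrow> nat) \<Rightarrow> ereal" where
  "markov_sup a = (SUP j. ereal (markov_lambda a j))"

definition markov_spectrum :: "real set" where
  "markov_spectrum = {x. \<exists>a. (\<forall>i. a i \<ge> 1) \<and> markov_sup a = ereal x}"

definition maximal_gap :: "real set \<Rightarrow> bool" where
  "maximal_gap G \<longleftrightarrow> G \<in> components (- markov_spectrum) \<and> bounded G"

text \<open>The word \<open>xs\<close> followed by infinitely many copies of the (nonempty) word \<open>ys\<close>.\<close>

definition ev_periodic :: "nat list \<Rightarrow> nat list \<Rightarrow> nat \<Rightarrow> nat" where
  "ev_periodic xs ys i =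
     (if i < length xs then xs ! i else ys ! ((i - length xs) mod length ys))"

definition gap_limit :: real ("\<nu>") where
  "\<nu> = cfrac (ev_periodic [4,3,1,3,1,3] [4,4,4,3,2,3])
     + cfrac (ev_periodic [0,3,1,3,1,2,1,1,3,3] [3,1,3,1,2,1])"

end

theory Submission
  imports Defs
begin

text \<open>
  Let \<open>x < \<nu>\<close> be a point of the spectrum close to \<open>\<nu>\<close>, attained at position \<open>0\<close> of a sequence \<open>a\<close>.
  A finite search shows that, up to reflection, \<open>a\<close> agrees around \<open>0\<close> with the sequence defining \<open>\<nu>\<close>
  on a fixed central word.  From there on the two tails defining \<open>\<nu>\<close> are the largest ones
  compatible with \<open>\<lambda>\<^sub>j(a) \<le> \<nu>\<close> for all \<open>j\<close>: a larger first deviation would create one of finitely many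
  forbidden words.  Hence \<open>x = \<nu> - l - r\<close> with deviations \<open>l, r \<ge> 0\<close> of the left and right tails.
  In every period \<open>4,4,4,3,2,3\<close> the left deviations avoid an interval \<open>(U, V)\<close> with \<open>V > 44 U\<close>, and such an
  interval always meets a gap of length more than \<open>U\<close> of the right deviations.  This yields arbitrarily
  small \<open>t\<close> which are not of the form \<open>l + r\<close>, so that \<open>\<nu> - t\<close> lies in a gap.  Since the spectrum is
  closed below \<open>5\<close> and contains \<open>\<nu>\<close>, the right ends of these gaps tend to \<open>\<nu>\<close>.
\<close>

section \<open>Convergents\<close>

definition pos_seq :: "(nat \<Rightarrow> nat) \<Rightarrow> bool" where
  "pos_seq s \<longleftrightarrow> (\<forall>i. 1 \<le> s i)"

abbreviation (input) shift :: "nat \<Rightarrow> (nat \<Rightarrow> 'a) \<Rightarrow> nat \<Rightarrow> 'a" where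
  "shift n s \<equiv> (\<lambda>i. s (n + i))"

lemma pos_seqD: "pos_seq s \<Longrightarrow> 1 \<le> s i"
  by (simp add: pos_seq_def)

lemma pos_seq_shift: "pos_seq s \<Longrightarrow> pos_seq (shift n s)"
  by (simp add: pos_seq_def)

text \<open>\<open>cf_fun n s y\<close> is [0; s 0, ..., s (n - 1), y]. The recursion absorbs
  entries from the inside, so that y plays the role of the complete quotient at index n.\<close>

primrec cf_fun :: "nat \<Rightarrow> (nat \<Rightarrow> nat) \<Rightarrow> real \<Rightarrow> real" where
  "cf_fun 0 s y = 1 / y"
| "cf_fun (Suc n) s y = cf_fun n s (real (s n) + 1 / y)"

text \<open>\<open>cf_den s (n + 1)\<close> is the denominator of the convergent \<open>[0; s 0, \<dots>, s (n - 1)]\<close>.\<close>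

fun cf_den :: "(nat \<Rightarrow> nat) \<Rightarrow> nat \<Rightarrow> real" where
  "cf_den s 0 = 0"
| "cf_den s (Suc 0) = 1"
| "cf_den s (Suc (Suc n)) = real (s n) * cf_den s (Suc n) + cf_den s n"

lemma cf_den_step:
  assumes "pos_seq s" "0 \<le> cf_den s n" "1 \<le> cf_den s (Suc n)"
  shows "cf_den s (Suc n) + cf_den s n \<le> cf_den s (Suc (Suc n))"
proof -
  have "1 * cf_den s (Suc n) \<le> real (s n) * cf_den s (Suc n)"
    using pos_seqD[OF assms(1), of n] assms by (intro mult_right_mono) auto
  then show ?thesis by simp
qed

lemma cf_den_pos:
  assumes "pos_seq s"
  shows "0 \<le> cf_den s n \<and> 1 \<le> cf_den s (Suc n)"
proof (induction n)
  case (Suc n)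
  then show ?case using cf_den_step[OF assms, of n] by linarith
qed auto

lemma cf_den_bounds:
  assumes "pos_seq s"
  shows "0 \<le> cf_den s n" "1 \<le> cf_den s (Suc n)" "cf_den s n \<le> cf_den s (Suc n)"
    "real n \<le> cf_den s (Suc n)"
proof -
  show "0 \<le> cf_den s n" "1 \<le> cf_den s (Suc n)" using cf_den_pos[OF assms] by auto
  show "cf_den s n \<le> cf_den s (Suc n)"
  proof (cases n)
    case (Suc m)
    then show ?thesis
      using cf_den_step[OF assms, of m] cf_den_pos[OF assms, of m] unfolding Suc by linarith
  qed simp
  show "real n \<le> cf_den s (Suc n)"
  proof (induction n)
    case (Suc n)
    show ?case
    proof (cases n)
      case (Suc m)
      have "1 \<le> cf_den s n" using cf_den_pos[OF assms, of m] Suc by simp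
      then show ?thesis
        using cf_den_step[OF assms, of n] cf_den_pos[OF assms, of n] Suc.IH by linarith
    qed (use cf_den_pos[OF assms, of 1] in simp)
  qed simp
qed

text \<open>With q, q' the last two denominators, \<open>cf_fun n s\<close> is a Moebius map with
  denominator q y + q' and determinant 1 or -1. Each substitution of \<open>s n + 1 / y\<close> for
  y reverses the order once, which accounts for the sign.\<close>

lemma cf_fun_diff:
  assumes "pos_seq s" "0 < y" "0 < z"
  shows "cf_fun n s y - cf_fun n s z = (-1) ^ n * (z - y) /
    ((cf_den s (Suc n) * y + cf_den s n) * (cf_den s (Suc n) * z + cf_den s n))"
  using assms(2,3)
proof (induction n arbitrary: y z)
  case 0
  then show ?case by (simp add: field_simps)
next
  case (Suc n)
  note b = cf_den_bounds[OF assms(1), of n]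
  let ?q = "cf_den s (Suc n)" and ?r = "cf_den s n" and ?d = "real (s n)"
  have d: "?d > 0" using pos_seqD[OF assms(1), of n] by simp
  have p: "0 < ?d + 1 / t" if "0 < t" for t using d that by (simp add: add_pos_pos)
  have e: "?q * (?d + 1 / t) + ?r = (cf_den s (Suc (Suc n)) * t + ?q) / t" if "0 < t" for t
    using that by (simp add: field_simps)
  have f: "0 < cf_den s (Suc (Suc n)) * t + ?q" if "0 < t" for t
    using that b cf_den_bounds[OF assms(1), of "Suc n"] by (intro add_pos_pos mult_pos_pos) auto
  have g: "(?d + 1 / z) - (?d + 1 / y) = - (z - y) / (y * z)"
    using Suc.prems by (simp add: field_simps)
  have h: "s1 * (- w / (y * z)) / (P / y * (R / z)) = - s1 * w / (P * R)"
    if "P > 0" "R > 0" for s1 w P R :: real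
    using that Suc.prems by (simp add: field_simps)
  show ?case
    using Suc.IH[OF p[OF Suc.prems(1)] p[OF Suc.prems(2)]]
    unfolding e[OF Suc.prems(1)] e[OF Suc.prems(2)] g h[OF f[OF Suc.prems(1)] f[OF Suc.prems(2)]]
    by simp
qed

lemma cf_fun_abs_diff:
  assumes "pos_seq s" "0 < y" "0 < z"
  shows "\<bar>cf_fun n s y - cf_fun n s z\<bar> = \<bar>y - z\<bar> /
    ((cf_den s (Suc n) * y + cf_den s n) * (cf_den s (Suc n) * z + cf_den s n))"
proof -
  note b = cf_den_bounds[OF assms(1), of n]
  have "0 < cf_den s (Suc n) * y + cf_den s n" "0 < cf_den s (Suc n) * z + cf_den s n"
    using b assms by (auto intro!: mult_pos_pos add_pos_nonneg)
  then show ?thesis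
    unfolding cf_fun_diff[OF assms] abs_divide abs_mult power_abs
    by (simp add: abs_minus_commute)
qed

text \<open>Since 0 <= q' <= q, the factor q y + q' lies between q y and q (y + 1). The first
  estimate gives this bound, the second gives \<open>cf_fun_abs_ge\<close>; both have scale 1 / q^2
  and no longer mention q'.\<close>

lemma cf_fun_abs_le:
  assumes "pos_seq s" "0 < y" "0 < z"
  shows "\<bar>cf_fun n s y - cf_fun n s z\<bar> \<le> \<bar>1 / y - 1 / z\<bar> / (cf_den s (Suc n))\<^sup>2"
proof -
  let ?q = "cf_den s (Suc n)"
  note b = cf_den_bounds[OF assms(1), of n]
  have pos: "0 < ?q * y * (?q * z)" using b assms by (intro mult_pos_pos) auto
  have "?q * y * (?q * z) \<le> (?q * y + cf_den s n) * (?q * z + cf_den s n)"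
    using b assms by (intro mult_mono) auto
  then have "\<bar>y - z\<bar> / ((?q * y + cf_den s n) * (?q * z + cf_den s n)) \<le> \<bar>y - z\<bar> / (?q * y * (?q * z))"
    using pos by (intro divide_left_mono) (auto intro: mult_pos_pos less_le_trans)
  also have "\<dots> = \<bar>1 / y - 1 / z\<bar> / ?q\<^sup>2"
  proof -
    have "\<bar>1 / y - 1 / z\<bar> = \<bar>(z - y) / (y * z)\<bar>" using assms by (simp add: field_simps)
    also have "\<dots> = \<bar>y - z\<bar> / (y * z)" using assms by (simp add: abs_divide abs_minus_commute)
    finally show ?thesis using assms b by (simp add: field_simps power2_eq_square)
  qed
  finally show ?thesis by (simp add: cf_fun_abs_diff[OF assms])
qed

lemma cf_fun_abs_ge:
  assumes "pos_seq s" "0 < y" "0 < z"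
  shows "\<bar>1 / (y + 1) - 1 / (z + 1)\<bar> / (cf_den s (Suc n))\<^sup>2 \<le> \<bar>cf_fun n s y - cf_fun n s z\<bar>"
proof -
  let ?q = "cf_den s (Suc n)"
  note b = cf_den_bounds[OF assms(1), of n]
  have pos: "0 < (?q * y + cf_den s n) * (?q * z + cf_den s n)"
    using b assms by (intro mult_pos_pos add_pos_nonneg) auto
  have "(?q * y + cf_den s n) * (?q * z + cf_den s n) \<le> (?q * (y + 1)) * (?q * (z + 1))"
    using b assms by (intro mult_mono) (auto simp: algebra_simps intro!: add_nonneg_nonneg)
  then have "\<bar>y - z\<bar> / ((?q * (y + 1)) * (?q * (z + 1))) \<le>
      \<bar>y - z\<bar> / ((?q * y + cf_den s n) * (?q * z + cf_den s n))"
    using pos by (intro divide_left_mono) (auto intro: mult_pos_pos less_le_trans)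
  moreover have "\<bar>y - z\<bar> / ((?q * (y + 1)) * (?q * (z + 1))) = \<bar>1 / (y + 1) - 1 / (z + 1)\<bar> / ?q\<^sup>2"
  proof -
    have "\<bar>1 / (y + 1) - 1 / (z + 1)\<bar> = \<bar>(z - y) / ((y + 1) * (z + 1))\<bar>"
      using assms by (simp add: field_simps)
    also have "\<dots> = \<bar>y - z\<bar> / ((y + 1) * (z + 1))"
      using assms by (simp add: abs_divide abs_minus_commute)
    finally show ?thesis by (simp add: power2_eq_square ac_simps)
  qed
  ultimately show ?thesis by (simp add: cf_fun_abs_diff[OF assms])
qed

section \<open>Convergence of continued fractions\<close>

lemma cfrac_conv_ge_1: "pos_seq s \<Longrightarrow> 1 \<le> cfrac_conv n s"
proof (induction n arbitrary: s)
  case 0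
  then show ?case using pos_seqD[of s 0] by simp
next
  case (Suc n)
  have "1 \<le> cfrac_conv n (\<lambda>i. s (Suc i))" using Suc.IH[of "\<lambda>i. s (Suc i)"] Suc.prems
    by (simp add: pos_seq_def)
  then have "0 \<le> 1 / cfrac_conv n (\<lambda>i. s (Suc i))" by simp
  moreover have "1 \<le> real (s 0)" using pos_seqD[OF Suc.prems, of 0] by simp
  ultimately show ?case unfolding cfrac_conv.simps by linarith
qed

lemma cf_fun_conv: "1 / cfrac_conv (n + m) s = cf_fun n s (cfrac_conv m (shift n s))"
proof (induction n arbitrary: m)
  case (Suc n)
  have "1 / cfrac_conv (Suc n + m) s = cf_fun n s (cfrac_conv (Suc m) (shift n s))"
    using Suc[of "Suc m"] by simp
  then show ?case by simp
qed simp

text \<open>Both convergents share their first n entries, so they are values of the same map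
  \<open>cf_fun n s\<close> at remainders whose reciprocals lie in (0, 1].\<close>

lemma recip_conv_diff:
  assumes "pos_seq s"
  shows "\<bar>1 / cfrac_conv (n + k) s - 1 / cfrac_conv (n + m) s\<bar> \<le> 1 / (cf_den s (Suc n))\<^sup>2"
proof -
  have *: "1 \<le> cfrac_conv k (shift n s)" for k
    using cfrac_conv_ge_1 pos_seq_shift[OF assms] .
  have r: "0 < 1 / cfrac_conv k (shift n s) \<and> 1 / cfrac_conv k (shift n s) \<le> 1" for k
    using *[of k] by (auto simp: field_simps)
  have "\<bar>1 / cfrac_conv k (shift n s) - 1 / cfrac_conv m (shift n s)\<bar> \<le> 1"
    using r[of k] r[of m] by linarith
  then have "\<bar>1 / cfrac_conv k (shift n s) - 1 / cfrac_conv m (shift n s)\<bar> / (cf_den s (Suc n))\<^sup>2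
      \<le> 1 / (cf_den s (Suc n))\<^sup>2"
    by (intro divide_right_mono) auto
  then show ?thesis unfolding cf_fun_conv
    using cf_fun_abs_le[OF assms, of "cfrac_conv k (shift n s)" "cfrac_conv m (shift n s)" n]
      *[of k] *[of m] by linarith
qed

lemma recip_conv_diff_Suc:
  assumes "pos_seq s"
  shows "\<bar>1 / cfrac_conv (Suc n + k) s - 1 / cfrac_conv (Suc n + m) s\<bar> \<le> 1 / (Suc n)"
proof -
  have "real (Suc n) \<le> cf_den s (Suc (Suc n))" using cf_den_bounds[OF assms, of "Suc n"] by simp
  then have "real (Suc n) * 1 \<le> cf_den s (Suc (Suc n)) * cf_den s (Suc (Suc n))"
    using cf_den_bounds[OF assms, of "Suc n"] by (intro mult_mono) auto
  then have "1 / (cf_den s (Suc (Suc n)))\<^sup>2 \<le> 1 / real (Suc n)"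
    by (intro divide_left_mono) (auto simp: power2_eq_square intro: less_le_trans mult_pos_pos)
  with recip_conv_diff[OF assms, of "Suc n" k m] show ?thesis by linarith
qed

lemma convergent_recip:
  assumes "pos_seq s"
  shows "convergent (\<lambda>n. 1 / cfrac_conv n s)"
proof (rule real_Cauchy_convergent, rule CauchyI)
  fix e :: real assume "0 < e"
  then obtain N where N: "1 / real (Suc N) < e" using nat_approx_posE by blast
  have "norm (1 / cfrac_conv m s - 1 / cfrac_conv n s) < e" if "m \<ge> Suc N" "n \<ge> Suc N" for m n
    using recip_conv_diff_Suc[OF assms, of N "m - Suc N" "n - Suc N"] that N by simp
  then show "\<exists>M. \<forall>m\<ge>M. \<forall>n\<ge>M. norm (1 / cfrac_conv m s - 1 / cfrac_conv n s) < e" by blast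
qed

lemma convergent_conv:
  assumes "pos_seq (shift 1 s)"
  shows "convergent (\<lambda>n. cfrac_conv n s)"
proof -
  have "convergent (\<lambda>n. real (s 0) + 1 / cfrac_conv n (\<lambda>i. s (Suc i)))"
    using convergent_recip[OF assms] by (intro convergent_add convergent_const) simp
  then have "convergent (\<lambda>n. cfrac_conv (Suc n) s)" by simp
  then show ?thesis by (rule convergent_Suc_iff[THEN iffD1])
qed

lemma cfrac_tendsto: "pos_seq s \<Longrightarrow> (\<lambda>n. cfrac_conv n s) \<longlonglongrightarrow> cfrac s"
  using convergent_conv[of s] pos_seq_shift[of s 1] unfolding cfrac_def by (simp add: convergent_LIMSEQ_iff)

lemma cfrac_ge_1: "pos_seq s \<Longrightarrow> 1 \<le> cfrac s"
  by (rule LIMSEQ_le_const[OF cfrac_tendsto]) (auto intro: cfrac_conv_ge_1)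

text \<open>Positivity is asked only from index 1 on, which admits the integer part 0 of
  [0; ...].\<close>

lemma cfrac_unfold_tail:
  assumes "pos_seq (shift 1 s)"
  shows "cfrac s = real (s 0) + 1 / cfrac (shift 1 s)"
proof -
  have "(\<lambda>n. real (s 0) + 1 / cfrac_conv n (shift 1 s)) \<longlonglongrightarrow> real (s 0) + 1 / cfrac (shift 1 s)"
    using cfrac_ge_1[OF assms] by (intro tendsto_intros cfrac_tendsto assms) auto
  then have "(\<lambda>n. cfrac_conv (Suc n) s) \<longlonglongrightarrow> real (s 0) + 1 / cfrac (shift 1 s)" by simp
  then have "(\<lambda>n. cfrac_conv n s) \<longlonglongrightarrow> real (s 0) + 1 / cfrac (shift 1 s)"
    by (rule LIMSEQ_imp_Suc)
  then show ?thesis unfolding cfrac_def by (rule limI)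
qed

lemma cfrac_unfold: "pos_seq s \<Longrightarrow> cfrac s = real (s 0) + 1 / cfrac (shift 1 s)"
  using cfrac_unfold_tail[of s] pos_seq_shift[of s 1] by blast

lemma cfrac_case_nat: "pos_seq s \<Longrightarrow> cfrac (case_nat 0 s) = 1 / cfrac s"
  using cfrac_unfold_tail[of "case_nat 0 s"] by simp

lemma cf_fun_tail: "pos_seq s \<Longrightarrow> 1 / cfrac s = cf_fun n s (cfrac (shift n s))"
proof (induction n)
  case (Suc n)
  have "cfrac (shift n s) = real (s n) + 1 / cfrac (shift (Suc n) s)"
    using cfrac_unfold[OF pos_seq_shift[OF Suc.prems, of n]] by simp
  with Suc show ?case by simp
qed simp

text \<open>The error is bounded independently of s; this makes the convergence uniform over
  sequences in \<open>continuous_on_markov_lambda\<close>.\<close>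

lemma recip_conv_approx:
  assumes "pos_seq s"
  shows "\<bar>1 / cfrac_conv (Suc n) s - 1 / cfrac s\<bar> \<le> 1 / (Suc n)"
proof -
  have "(\<lambda>k. \<bar>1 / cfrac_conv (Suc n) s - 1 / cfrac_conv (Suc n + k) s\<bar>)
      \<longlonglongrightarrow> \<bar>1 / cfrac_conv (Suc n) s - 1 / cfrac s\<bar>"
    using cfrac_ge_1[OF assms] LIMSEQ_ignore_initial_segment[OF cfrac_tendsto[OF assms], of "Suc n"]
    by (intro tendsto_intros) (auto simp: add.commute)
  then show ?thesis
    using recip_conv_diff_Suc[OF assms, of n 0] by (intro LIMSEQ_le_const2) auto
qed

section \<open>Bounds from finite words\<close>

lemma recip_le: "0 < x \<Longrightarrow> x \<le> y \<Longrightarrow> 1 / y \<le> 1 / (x :: real)"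
  by (simp add: frac_le)

section \<open>The two tails at a position, read outwards\<close>

definition lft :: "(int \<Rightarrow> nat) \<Rightarrow> int \<Rightarrow> nat \<Rightarrow> nat" where
  "lft a j i = a (j - 1 - int i)"

definition rgt :: "(int \<Rightarrow> nat) \<Rightarrow> int \<Rightarrow> nat \<Rightarrow> nat" where
  "rgt a j i = a (j + 1 + int i)"

definition reflect :: "(int \<Rightarrow> nat) \<Rightarrow> int \<Rightarrow> nat" where
  "reflect a i = a (- i)"

lemma lft_reflect: "lft (reflect a) j = rgt a (- j)"
  unfolding lft_def rgt_def reflect_def by (intro ext arg_cong[of _ _ a]) simp

lemma rgt_reflect: "rgt (reflect a) j = lft a (- j)"
  by (rule ext) (simp add: lft_def rgt_def reflect_def minus_diff_commute)

lemma pos_seq_sides: "\<forall>i. 1 \<le> a i \<Longrightarrow> pos_seq (lft a j)" "\<forall>i. 1 \<le> a i \<Longrightarrow> pos_seq (rgt a j)"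
  by (simp_all add: pos_seq_def lft_def rgt_def)

lemma markov_lambda_eq:
  assumes "\<forall>i. 1 \<le> a i"
  shows "markov_lambda a j = real (a j) + 1 / cfrac (lft a j) + 1 / cfrac (rgt a j)"
proof -
  have 1: "shift 1 (\<lambda>i. a (j - int i)) = lft a j"
    by (rule ext) (simp add: lft_def algebra_simps)
  have "cfrac (\<lambda>i. a (j - int i)) = real (a j) + 1 / cfrac (lft a j)"
    using cfrac_unfold_tail[of "\<lambda>i. a (j - int i)"] pos_seq_sides[OF assms, of j] unfolding 1 by simp
  moreover have "(\<lambda>i. a (j + 1 + int i)) = rgt a j"
    by (rule ext) (simp add: rgt_def)
  ultimately show ?thesis
    unfolding markov_lambda_def using cfrac_case_nat[OF pos_seq_sides(2)[OF assms, of j]] by simp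
qed

lemma markov_lambda_reflect:
  assumes "\<forall>i. 1 \<le> a i"
  shows "markov_lambda (reflect a) j = markov_lambda a (- j)"
proof -
  have "\<forall>i. 1 \<le> reflect a i" using assms by (simp add: reflect_def)
  then show ?thesis using assms
    by (simp add: markov_lambda_eq lft_reflect rgt_reflect) (simp add: reflect_def)
qed

text \<open>If all lambda-values are below 5, no entry exceeds 4, so only such tails occur near
  \<open>\<nu>\<close>.\<close>

definition seq4 :: "(nat \<Rightarrow> nat) \<Rightarrow> bool" where
  "seq4 s \<longleftrightarrow> (\<forall>i. s i \<in> {1..4})"

lemma seq4_pos: "seq4 s \<Longrightarrow> pos_seq s"
  by (simp add: seq4_def pos_seq_def)

lemma seq4_shift: "seq4 s \<Longrightarrow> seq4 (shift n s)"
  by (simp add: seq4_def)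

lemma seq4_sides: "\<forall>i. a i \<in> {1..4} \<Longrightarrow> seq4 (lft a j)" "\<forall>i. a i \<in> {1..4} \<Longrightarrow> seq4 (rgt a j)"
  by (simp_all add: seq4_def lft_def rgt_def)

text \<open>Dropping everything after two entries gives at least 1 + 1/5; feeding this bound back
  into the tail gives at most 4 + 5/6 = 29/6.\<close>

lemma cfrac_seq4:
  assumes "seq4 s"
  shows "6 / 5 \<le> cfrac s" "cfrac s \<le> 29 / 6"
proof -
  have *: "6 / 5 \<le> cfrac t" if "seq4 t" for t
  proof -
    define x y where "x = cfrac (shift 1 t)" and "y = cfrac (shift 2 t)"
    have "cfrac t = real (t 0) + 1 / x" "x = real (t 1) + 1 / y"
      using cfrac_unfold[OF seq4_pos[OF that]] cfrac_unfold[OF pos_seq_shift[OF seq4_pos[OF that]], of 1]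
      by (simp_all add: x_def y_def numeral_2_eq_2)
    moreover have "1 \<le> x" "1 \<le> y" unfolding x_def y_def
      using cfrac_ge_1 pos_seq_shift[OF seq4_pos[OF that]] by blast+
    moreover have "1 / y \<le> 1" using \<open>1 \<le> y\<close> by simp
    moreover have "real (t 0) \<ge> 1" "real (t 1) \<le> 4" using that by (auto simp: seq4_def)
    ultimately have "x \<le> 5" "cfrac t \<ge> 1 + 1 / x" by linarith+
    moreover have "1 / 5 \<le> 1 / x" using \<open>x \<le> 5\<close> \<open>1 \<le> x\<close> by (intro recip_le) auto
    ultimately show ?thesis by simp
  qed
  show "6 / 5 \<le> cfrac s" using *[OF assms] .
  have "6 / 5 \<le> cfrac (shift 1 s)" using *[OF seq4_shift[OF assms]] .
  then have "1 / cfrac (shift 1 s) \<le> 1 / (6 / 5)" by (intro recip_le) auto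
  moreover have "real (s 0) \<le> 4" using assms by (auto simp: seq4_def)
  ultimately show "cfrac s \<le> 29 / 6" using cfrac_unfold[OF seq4_pos[OF assms]] by simp
qed

text \<open>Words are lists of integers, so that the bounds derived from them are decided in exact
  integer arithmetic.\<close>

definition agrees :: "int list \<Rightarrow> (nat \<Rightarrow> nat) \<Rightarrow> bool" where
  "agrees w s \<longleftrightarrow> (\<forall>i < length w. int (s i) = w ! i)"

lemma agrees_Nil [simp]: "agrees [] s"
  by (simp add: agrees_def)

lemma agrees_Cons: "agrees (d # w) s \<longleftrightarrow> int (s 0) = d \<and> agrees w (shift 1 s)"
  by (auto simp: agrees_def nth_Cons split: nat.splits)

lemma agrees_snoc: "agrees (w @ [d]) s \<longleftrightarrow> agrees w s \<and> int (s (length w)) = d"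
  by (auto simp: agrees_def nth_append less_Suc_eq)

text \<open>Numerator and denominator of the largest (\<open>b = True\<close>) or least (\<open>b = False\<close>) value of
  \<open>[w; y]\<close> for \<open>6/5 \<le> y \<le> 29/6\<close>.\<close>

fun cf_bound :: "bool \<Rightarrow> int list \<Rightarrow> int \<times> int" where
  "cf_bound b [] = (if b then (29, 6) else (6, 5))"
| "cf_bound b (d # w) = (case cf_bound (\<not> b) w of (n, m) \<Rightarrow> (d * n + m, n))"

text \<open>Taking reciprocals reverses the inequality, hence b alternates along the word.
  Positivity is carried along to allow the divisions.\<close>

lemma cf_bound_sound:
  assumes "seq4 s" "agrees w s"
  shows "0 < fst (cf_bound b w) \<and> 0 < snd (cf_bound b w) \<and>
    (if b then cfrac s \<le> fst (cf_bound b w) / snd (cf_bound b w)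
     else fst (cf_bound b w) / snd (cf_bound b w) \<le> cfrac s)"
  using assms
proof (induction w arbitrary: s b)
  case Nil
  then show ?case using cfrac_seq4[OF Nil(1)] by simp
next
  case (Cons d w)
  obtain n m where nm: "cf_bound (\<not> b) w = (n, m)" by (cases "cf_bound (\<not> b) w")
  define y where "y = cfrac (shift 1 s)"
  have d: "int (s 0) = d" and ag: "agrees w (shift 1 s)" using Cons.prems(2) by (simp_all add: agrees_Cons)
  have dpos: "0 < d" using Cons.prems(1) d by (auto simp: seq4_def dest: spec[of _ 0])
  have IH: "0 < n" "0 < m" "if b then n / m \<le> y else y \<le> n / m"
    using Cons.IH[OF seq4_shift[OF Cons.prems(1)] ag, of "\<not> b"] nm by (auto simp: y_def split: if_splits)
  have y: "1 \<le> y" unfolding y_def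
    by (intro cfrac_ge_1 pos_seq_shift seq4_pos Cons.prems)
  have e: "cfrac s = d + 1 / y"
    using cfrac_unfold[OF seq4_pos[OF Cons.prems(1)]] d by (simp add: y_def)
  have "(d * n + m) / n = d + 1 / (n / m)" using IH by (simp add: field_simps)
  moreover have "if b then 1 / y \<le> 1 / (n / m) else 1 / (n / m) \<le> 1 / y"
    using IH y recip_le[of "n / m" y] recip_le[of y "n / m"] by (cases b) auto
  moreover have "cf_bound b (d # w) = (d * n + m, n)" using nm by simp
  moreover have "0 < d * n + m" using IH dpos by (simp add: add_pos_pos)
  ultimately show ?case using IH by (cases b) (auto simp: e)
qed

text \<open>This is p / q < c + m / n + m' / n' with denominators cleared. The largest tails have
  the least reciprocals, so upper bounds on the tails bound the lambda-value from below;
  \<open>lam_lt\<close> is dual.\<close>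

definition lam_gt :: "int \<Rightarrow> int \<Rightarrow> int list \<Rightarrow> int \<Rightarrow> int list \<Rightarrow> bool" where
  "lam_gt p q l c r = (case cf_bound True l of (n, m) \<Rightarrow> case cf_bound True r of (n', m') \<Rightarrow>
     p * (n * n') < q * (c * (n * n') + m * n' + m' * n))"

definition lam_lt :: "int \<Rightarrow> int \<Rightarrow> int list \<Rightarrow> int \<Rightarrow> int list \<Rightarrow> bool" where
  "lam_lt p q l c r = (case cf_bound False l of (n, m) \<Rightarrow> case cf_bound False r of (n', m') \<Rightarrow>
     q * (c * (n * n') + m * n' + m' * n) < p * (n * n'))"

definition window :: "(int \<Rightarrow> nat) \<Rightarrow> int \<Rightarrow> int list \<Rightarrow> int \<Rightarrow> int list \<Rightarrow> bool" where
  "window a j l c r \<longleftrightarrow> agrees l (lft a j) \<and> int (a j) = c \<and> agrees r (rgt a j)"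

lemma window_reflect: "window (reflect a) (- j) r c l \<longleftrightarrow> window a j l c r"
  by (auto simp: window_def lft_reflect rgt_reflect) (auto simp: reflect_def)

lemma lam_gt_sound:
  assumes a: "\<forall>i. a i \<in> {1..4}" and w: "window a j l c r" and q: "0 < q" and gt: "lam_gt p q l c r"
  shows "p / q < markov_lambda a j"
proof -
  obtain n m where nm: "cf_bound True l = (n, m)" by (cases "cf_bound True l")
  obtain n' m' where nm': "cf_bound True r = (n', m')" by (cases "cf_bound True r")
  define x y where "x = cfrac (lft a j)" and "y = cfrac (rgt a j)"
  have b: "0 < n" "0 < m" "x \<le> n / m" "0 < n'" "0 < m'" "y \<le> n' / m'"
    using cf_bound_sound[OF seq4_sides(1)[OF a], of l j True] cf_bound_sound[OF seq4_sides(2)[OF a], of r j True]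
      w nm nm' by (auto simp: window_def x_def y_def)
  have "1 \<le> x" "1 \<le> y" unfolding x_def y_def
    using cfrac_ge_1 seq4_pos seq4_sides a by blast+
  have "1 / (n / m) \<le> 1 / x" "1 / (n' / m') \<le> 1 / y"
    using b \<open>1 \<le> x\<close> \<open>1 \<le> y\<close> by (intro recip_le; simp)+
  moreover have "markov_lambda a j = c + 1 / x + 1 / y"
    using markov_lambda_eq[of a j] a w unfolding x_def y_def window_def
    by (metis atLeastAtMost_iff of_int_of_nat_eq)
  ultimately have le: "c + m / n + m' / n' \<le> markov_lambda a j" by simp
  have "real_of_int (p * (n * n')) < real_of_int (q * (c * (n * n') + m * n' + m' * n))"
    using gt unfolding lam_gt_def nm nm' by (simp only: prod.case of_int_less_iff)
  then have "p / q < c + m / n + m' / n'"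
    using b q by (simp add: field_simps)
  with le show ?thesis by simp
qed

lemma lam_lt_sound:
  assumes a: "\<forall>i. a i \<in> {1..4}" and w: "window a j l c r" and q: "0 < q" and lt: "lam_lt p q l c r"
  shows "markov_lambda a j < p / q"
proof -
  obtain n m where nm: "cf_bound False l = (n, m)" by (cases "cf_bound False l")
  obtain n' m' where nm': "cf_bound False r = (n', m')" by (cases "cf_bound False r")
  define x y where "x = cfrac (lft a j)" and "y = cfrac (rgt a j)"
  have b: "0 < n" "0 < m" "n / m \<le> x" "0 < n'" "0 < m'" "n' / m' \<le> y"
    using cf_bound_sound[OF seq4_sides(1)[OF a], of l j False] cf_bound_sound[OF seq4_sides(2)[OF a], of r j False]
      w nm nm' by (auto simp: window_def x_def y_def)
  have "1 / x \<le> 1 / (n / m)" "1 / y \<le> 1 / (n' / m')"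
    using b by (intro recip_le; simp)+
  moreover have "markov_lambda a j = c + 1 / x + 1 / y"
    using markov_lambda_eq[of a j] a w unfolding x_def y_def window_def
    by (metis atLeastAtMost_iff of_int_of_nat_eq)
  ultimately have le: "markov_lambda a j \<le> c + m / n + m' / n'" by simp
  have "real_of_int (q * (c * (n * n') + m * n' + m' * n)) < real_of_int (p * (n * n'))"
    using lt unfolding lam_lt_def nm nm' by (simp only: prod.case of_int_less_iff)
  then have "c + m / n + m' / n' < p / q"
    using b q by (simp add: field_simps)
  with le show ?thesis by simp
qed

section \<open>Certificates for the finite search\<close>

datatype cert = Low | High | Kill_left nat | Kill_right nat | Found
  | Extend_left cert cert cert cert | Extend_right cert cert cert cert

text \<open>A certificate is a search tree over the words around a letter \<open>c\<close>; the words to its left and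
  right are read outwards.  A node is closed because the \<open>\<lambda>\<close>-value at \<open>c\<close> is below
  \<open>4.5278295384\<close>, because some \<open>\<lambda>\<close>-value is above \<open>4.52782953842\<close>, or because the word extends
  the target \<open>u, v\<close>; these two bounds enclose \<open>\<nu>\<close>.\<close>

fun check :: "int list \<Rightarrow> int list \<Rightarrow> int \<Rightarrow> cert \<Rightarrow> int list \<Rightarrow> int list \<Rightarrow> bool" where
  "check u v c Low l r = lam_lt 45278295384 10000000000 l c r"
| "check u v c High l r = lam_gt 452782953842 100000000000 l c r"
| "check u v c (Kill_left i) l r = (i < length l \<and>
     lam_gt 452782953842 100000000000 (drop (Suc i) l) (l ! i) (rev (take i l) @ c # r))"
| "check u v c (Kill_right i) l r = (i < length r \<and>
     lam_gt 452782953842 100000000000 (rev (take i r) @ c # l) (r ! i) (drop (Suc i) r))"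
| "check u v c Found l r = (take (length u) l = u \<and> take (length v) r = v \<or>
     take (length u) r = u \<and> take (length v) l = v)"
| "check u v c (Extend_left t1 t2 t3 t4) l r = (check u v c t1 (l @ [1]) r \<and> check u v c t2 (l @ [2]) r \<and>
     check u v c t3 (l @ [3]) r \<and> check u v c t4 (l @ [4]) r)"
| "check u v c (Extend_right t1 t2 t3 t4) l r = (check u v c t1 l (r @ [1]) \<and> check u v c t2 l (r @ [2]) \<and>
     check u v c t3 l (r @ [3]) \<and> check u v c t4 l (r @ [4]))"

lemma agrees_take: "agrees w s \<Longrightarrow> take n w = u \<Longrightarrow> agrees u s"
  by (auto simp: agrees_def)

text \<open>Recentring at the letter of index i on the left: the letters crossed appear reversed on
  the right, followed by the old centre. This justifies the \<open>Kill_left\<close> leaves.\<close>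

lemma window_left:
  assumes "window a j l c r" "i < length l"
  shows "window a (j - 1 - int i) (drop (Suc i) l) (l ! i) (rev (take i l) @ c # r)"
  unfolding window_def
proof (intro conjI)
  have l: "\<And>k. k < length l \<Longrightarrow> int (a (j - 1 - int k)) = l ! k"
    and c: "int (a j) = c" and r: "\<And>k. k < length r \<Longrightarrow> int (a (j + 1 + int k)) = r ! k"
    using assms(1) by (auto simp: window_def agrees_def lft_def rgt_def)
  show "int (a (j - 1 - int i)) = l ! i" using l assms(2) .
  show "agrees (drop (Suc i) l) (lft a (j - 1 - int i))"
    unfolding agrees_def lft_def
  proof (intro allI impI)
    fix k assume "k < length (drop (Suc i) l)"
    then show "int (a (j - 1 - int i - 1 - int k)) = drop (Suc i) l ! k"
      using l[of "Suc i + k"] by (simp add: algebra_simps)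
  qed
  show "agrees (rev (take i l) @ c # r) (rgt a (j - 1 - int i))"
    unfolding agrees_def rgt_def
  proof (intro allI impI)
    fix k assume k: "k < length (rev (take i l) @ c # r)"
    consider "k < i" | "k = i" | m where "k = Suc (i + m)"
      by (metis less_imp_Suc_add linorder_neqE_nat)
    then show "int (a (j - 1 - int i + 1 + int k)) = (rev (take i l) @ c # r) ! k"
    proof cases
      case 1
      then show ?thesis using l[of "i - Suc k"] assms(2)
        by (simp add: nth_append rev_nth of_nat_diff algebra_simps)
    next
      case 2
      then show ?thesis using c assms(2) by (simp add: nth_append)
    next
      case 3
      then show ?thesis using r[of m] k assms(2) by (simp add: nth_append algebra_simps)
    qed
  qed
qed

lemma window_right:
  assumes "window a j l c r" "i < length r"
  shows "window a (j + 1 + int i) (rev (take i r) @ c # l) (r ! i) (drop (Suc i) r)"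
proof -
  have "window (reflect a) (- j - 1 - int i) (drop (Suc i) r) (r ! i) (rev (take i r) @ c # l)"
    using window_left[of "reflect a" "- j" r c l i] assms by (simp add: window_reflect)
  moreover have "- j - 1 - int i = - (j + 1 + int i)" by simp
  ultimately show ?thesis using window_reflect by metis
qed

text \<open>The actual sequence follows exactly one branch at every extension node. A
  \<open>Low\<close>, \<open>High\<close> or kill leaf contradicts the bounds on the lambda-values,
  so the branch ends in \<open>Found\<close>; the search does not fix an orientation, whence the two
  alternatives.\<close>

lemma check_sound:
  assumes "check u v c t l r" "window a j l c r" "\<forall>i. a i \<in> {1..4}"
    and "\<And>i. markov_lambda a i \<le> 4.52782953842" "4.52782953840 \<le> markov_lambda a j"
  shows "agrees u (lft a j) \<and> agrees v (rgt a j) \<or> agrees u (rgt a j) \<and> agrees v (lft a j)"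
  using assms(1,2)
proof (induction t arbitrary: l r)
  case Low
  then show ?case using lam_lt_sound[OF assms(3), of j l c r 10000000000 45278295384] assms(5) by simp
next
  case High
  then show ?case using lam_gt_sound[OF assms(3), of j l c r 100000000000 452782953842] assms(4)[of j] by simp
next
  case (Kill_left i)
  then have i: "i < length l"
    and gt: "lam_gt 452782953842 100000000000 (drop (Suc i) l) (l ! i) (rev (take i l) @ c # r)" by auto
  show ?case using lam_gt_sound[OF assms(3) window_left[OF Kill_left.prems(2) i] _ gt]
    assms(4)[of "j - 1 - int i"] by simp
next
  case (Kill_right i)
  then have i: "i < length r"
    and gt: "lam_gt 452782953842 100000000000 (rev (take i r) @ c # l) (r ! i) (drop (Suc i) r)" by auto
  show ?case using lam_gt_sound[OF assms(3) window_right[OF Kill_right.prems(2) i] _ gt]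
    assms(4)[of "j + 1 + int i"] by simp
next
  case Found
  then show ?case using agrees_take by (auto simp: window_def)
next
  case (Extend_left t1 t2 t3 t4)
  have "int (lft a j (length l)) \<in> {1, 2, 3, 4}" using assms(3)[rule_format, of "j - 1 - int (length l)"]
    by (auto simp: lft_def)
  then consider "window a j (l @ [1]) c r" | "window a j (l @ [2]) c r" | "window a j (l @ [3]) c r"
    | "window a j (l @ [4]) c r" using Extend_left.prems(2) by (auto simp: window_def agrees_snoc)
  then show ?case using Extend_left.IH Extend_left.prems(1) by cases auto
next
  case (Extend_right t1 t2 t3 t4)
  have "int (rgt a j (length r)) \<in> {1, 2, 3, 4}" using assms(3)[rule_format, of "j + 1 + int (length r)"]
    by (auto simp: rgt_def)
  then consider "window a j l c (r @ [1])" | "window a j l c (r @ [2])" | "window a j l c (r @ [3])"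
    | "window a j l c (r @ [4])" using Extend_right.prems(2) by (auto simp: window_def agrees_snoc)
  then show ?case using Extend_right.IH Extend_right.prems(1) by cases auto
qed

section \<open>Compactness of the spectrum below 5\<close>

definition full4 :: "(int \<Rightarrow> nat) set" where
  "full4 = {a. \<forall>i. a i \<in> {1..4}}"

lemma full4_pos: "a \<in> full4 \<Longrightarrow> \<forall>i. 1 \<le> a i"
  by (simp add: full4_def)

text \<open>Tychonoff's theorem for a product of finite discrete sets.\<close>

lemma compact_full4: "compact full4"
proof -
  have "compactin (product_topology (\<lambda>_::int. euclidean) UNIV) (PiE UNIV (\<lambda>_. {1..4::nat}))"
    by (subst compactin_PiE) (auto simp: finite_imp_compact)
  moreover have "PiE UNIV (\<lambda>_. {1..4::nat}) = full4"
    by (auto simp: full4_def PiE_def Pi_def)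
  ultimately show ?thesis
    by (simp add: euclidean_product_topology)
qed

lemma closed_full4: "closed full4"
proof -
  have "full4 = (\<Inter>i. (\<lambda>a. a i) -` {1..4})" by (auto simp: full4_def)
  moreover have "closed ((\<lambda>a::int \<Rightarrow> nat. a i) -` {1..4})" for i
    by (rule closed_vimage) simp_all
  ultimately show ?thesis using closed_INT by (metis (no_types, lifting))
qed

lemma continuous_on_cfrac_conv:
  assumes "\<And>i. continuous_on S (\<lambda>x. g x i)" "\<And>x. x \<in> S \<Longrightarrow> pos_seq (g x)"
  shows "continuous_on S (\<lambda>x. cfrac_conv n (g x))"
  using assms
proof (induction n arbitrary: g)
  case 0
  then show ?case by (simp add: continuous_on_of_nat)
next
  case (Suc n)
  have p: "pos_seq (\<lambda>i. g x (Suc i))" if "x \<in> S" for x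
    using Suc.prems(2)[OF that] by (simp add: pos_seq_def)
  have "continuous_on S (\<lambda>x. cfrac_conv n (\<lambda>i. g x (Suc i)))"
    using Suc.prems p by (intro Suc.IH) auto
  moreover have "cfrac_conv n (\<lambda>i. g x (Suc i)) \<noteq> 0" if "x \<in> S" for x
    using cfrac_conv_ge_1[OF p[OF that], of n] by linarith
  ultimately show ?case
    unfolding cfrac_conv.simps
    by (intro continuous_on_add continuous_on_divide continuous_on_const continuous_on_of_nat Suc.prems(1) ballI)
qed

lemma continuous_on_coordinate: "continuous_on S (\<lambda>a::int \<Rightarrow> nat. a i)"
  by (rule continuous_on_subset[OF continuous_on_product_coordinates]) simp

text \<open>Replacing both tails by convergents gives continuous functions of finitely many
  coordinates, and these converge uniformly on \<open>full4\<close>.\<close>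

lemma continuous_on_markov_lambda: "continuous_on full4 (\<lambda>a. markov_lambda a j)"
proof (rule uniform_limit_theorem[where F = sequentially])
  let ?f = "\<lambda>n a. real (a j) + 1 / cfrac_conv (Suc n) (lft a j) + 1 / cfrac_conv (Suc n) (rgt a j)"
  note p = pos_seq_sides[OF full4_pos]
  have c: "continuous_on full4 (\<lambda>a. cfrac_conv n (lft a j))" "continuous_on full4 (\<lambda>a. cfrac_conv n (rgt a j))"
    for n using p unfolding lft_def rgt_def
    by (auto intro!: continuous_on_cfrac_conv continuous_on_coordinate)
  have nz: "cfrac_conv n (lft a j) \<noteq> 0" "cfrac_conv n (rgt a j) \<noteq> 0" if "a \<in> full4" for a n
    using cfrac_conv_ge_1[OF p(1)[OF that], of n j] cfrac_conv_ge_1[OF p(2)[OF that], of n j] by linarith+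
  show "\<forall>\<^sub>F n in sequentially. continuous_on full4 (?f n)"
    using nz by (intro always_eventually allI continuous_on_add continuous_on_divide continuous_on_const
        continuous_on_of_nat continuous_on_coordinate c ballI)
  show "uniform_limit full4 ?f (\<lambda>a. markov_lambda a j) sequentially"
  proof (rule uniform_limitI)
    fix e :: real assume "0 < e"
    then obtain N where N: "1 / real (Suc N) < e / 2" using nat_approx_posE[of "e / 2"] by auto
    have "dist (?f n a) (markov_lambda a j) < e" if "n \<ge> N" "a \<in> full4" for n a
    proof -
      have "1 / real (Suc n) \<le> 1 / real (Suc N)" using that by (intro recip_le) auto
      then have "2 / real (Suc n) < e" using N by simp
      then show ?thesis
        using recip_conv_approx[OF p(1)[OF that(2)], of n j] recip_conv_approx[OF p(2)[OF that(2)], of n j]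
        unfolding markov_lambda_eq[OF full4_pos[OF that(2)]] dist_real_def by linarith
    qed
    then show "\<forall>\<^sub>F n in sequentially. \<forall>a\<in>full4. dist (?f n a) (markov_lambda a j) < e"
      unfolding eventually_sequentially by blast
  qed
qed simp

lemma markov_lambda_ge:
  assumes "\<forall>i. 1 \<le> a i"
  shows "real (a j) \<le> markov_lambda a j"
  using cfrac_ge_1[OF pos_seq_sides(1)[OF assms, of j]] cfrac_ge_1[OF pos_seq_sides(2)[OF assms, of j]]
  by (simp add: markov_lambda_eq[OF assms])

lemma markov_lambda_translate: "markov_lambda (\<lambda>i. a (i + k)) j = markov_lambda a (j + k)"
  unfolding markov_lambda_def
  by (intro arg_cong2[of _ _ _ _ "(+)"] arg_cong[of _ _ cfrac] ext)
     (auto split: nat.splits intro!: arg_cong[of _ _ a])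

text \<open>A compact stand-in for the spectrum: it is contained in it, and it contains every
  spectral point below 5, because there the supremum can be attained at position 0.\<close>

definition spectrum4 :: "real set" where
  "spectrum4 = (\<lambda>a. markov_lambda a 0) ` {a \<in> full4. \<forall>j. markov_lambda a j \<le> markov_lambda a 0}"

lemma compact_spectrum4: "compact spectrum4"
proof -
  have cl: "closed {a \<in> full4. markov_lambda a j \<le> markov_lambda a 0}" for j
    by (intro continuous_on_closed_Collect_le continuous_on_markov_lambda closed_full4)
  have "{a \<in> full4. \<forall>j. markov_lambda a j \<le> markov_lambda a 0}
      = full4 \<inter> (\<Inter>j. {a \<in> full4. markov_lambda a j \<le> markov_lambda a 0})" by auto
  then have "compact {a \<in> full4. \<forall>j. markov_lambda a j \<le> markov_lambda a 0}"
    using cl by (simp add: compact_Int_closed compact_full4 closed_INT)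
  then show ?thesis unfolding spectrum4_def
    by (intro compact_continuous_image continuous_on_subset[OF continuous_on_markov_lambda]) auto
qed

lemma markov_supI:
  assumes "\<And>j. markov_lambda a j \<le> markov_lambda a 0"
  shows "markov_sup a = ereal (markov_lambda a 0)"
  unfolding markov_sup_def using assms by (intro antisym SUP_least SUP_upper) auto

lemma markov_spectrumI: "\<forall>i. 1 \<le> a i \<Longrightarrow> markov_sup a = ereal x \<Longrightarrow> x \<in> markov_spectrum"
  unfolding markov_spectrum_def by blast

lemma spectrum4_subset: "spectrum4 \<subseteq> markov_spectrum"
proof
  fix x assume "x \<in> spectrum4"
  then obtain a where "a \<in> full4" "\<And>j. markov_lambda a j \<le> markov_lambda a 0" "x = markov_lambda a 0"
    by (auto simp: spectrum4_def)
  then show "x \<in> markov_spectrum"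
    using markov_supI[of a] full4_pos[of a] markov_spectrumI by blast
qed

text \<open>The sequences over {1..4} with all lambda-values at most x form a compact set containing
  every translate of b. A maximizer of the value at position 0 on this set reaches at least the
  supremum for b, which is x.\<close>

lemma markov_spectrum_attained:
  assumes "x \<in> markov_spectrum" "x < 5"
  obtains a where "a \<in> full4" "markov_lambda a 0 = x" "\<And>j. markov_lambda a j \<le> x"
proof -
  obtain b where b: "\<forall>i. 1 \<le> b i" "markov_sup b = ereal x"
    using assms(1) by (auto simp: markov_spectrum_def)
  have le: "markov_lambda b j \<le> x" for j
  proof -
    have "ereal (markov_lambda b j) \<le> markov_sup b" unfolding markov_sup_def by (intro SUP_upper) simp
    then show ?thesis using b(2) by simp
  qed
  have b4: "b \<in> full4"
  proof -
    have "b j \<le> 4" for j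
    proof -
      have "real (b j) < 5" using markov_lambda_ge[OF b(1), of j] le[of j] assms(2) by linarith
      then show ?thesis by simp
    qed
    then show ?thesis using b(1) by (simp add: full4_def)
  qed
  define C where "C = {a \<in> full4. \<forall>j. markov_lambda a j \<le> x}"
  have cl: "closed {a \<in> full4. markov_lambda a j \<le> x}" for j
    by (intro continuous_on_closed_Collect_le continuous_on_markov_lambda continuous_on_const
        closed_full4)
  have "C = full4 \<inter> (\<Inter>j. {a \<in> full4. markov_lambda a j \<le> x})" unfolding C_def by auto
  then have "compact C"
    using cl by (simp add: compact_Int_closed compact_full4 closed_INT)
  moreover have "continuous_on C (\<lambda>a. markov_lambda a 0)"
    by (rule continuous_on_subset[OF continuous_on_markov_lambda]) (auto simp: C_def)
  moreover have shifts: "(\<lambda>i. b (i + k)) \<in> C" for k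
    using b4 le by (auto simp: C_def full4_def markov_lambda_translate)
  then have "C \<noteq> {}" by blast
  ultimately obtain a where a: "a \<in> C" "\<And>c. c \<in> C \<Longrightarrow> markov_lambda c 0 \<le> markov_lambda a 0"
    using continuous_attains_sup[of C "\<lambda>a. markov_lambda a 0"] by blast
  have "markov_lambda b k \<le> markov_lambda a 0" for k
    using a(2)[OF shifts[of k]] by (simp add: markov_lambda_translate)
  then have "markov_sup b \<le> ereal (markov_lambda a 0)"
    unfolding markov_sup_def by (intro SUP_least) simp
  then have "x \<le> markov_lambda a 0" using b(2) by simp
  then show ?thesis using that[of a] a(1) unfolding C_def by (auto intro: antisym)
qed

lemma markov_spectrum_subset: "x \<in> markov_spectrum \<Longrightarrow> x < 5 \<Longrightarrow> x \<in> spectrum4"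
  by (erule markov_spectrum_attained) (auto simp: spectrum4_def)

text \<open>By compactness of \<open>spectrum4\<close> there are nearest spectral points on both
  sides of x; the points y and z ensure that both sides are nonempty.\<close>

lemma maximal_gap_above:
  assumes "x \<notin> markov_spectrum" "y \<in> markov_spectrum" "y < x" "z \<in> markov_spectrum" "x < z" "z < 5"
  obtains \<alpha> \<beta> where "maximal_gap {\<alpha><..<\<beta>}" "x < \<beta>" "\<beta> \<le> z"
proof -
  have c: "compact (spectrum4 \<inter> {x..})" "compact (spectrum4 \<inter> {..x})"
    by (simp_all add: compact_Int_closed compact_spectrum4)
  have z: "z \<in> spectrum4 \<inter> {x..}" and y: "y \<in> spectrum4 \<inter> {..x}"
    using markov_spectrum_subset assms by auto
  obtain \<beta> where \<beta>: "\<beta> \<in> spectrum4 \<inter> {x..}" "\<And>t. t \<in> spectrum4 \<inter> {x..} \<Longrightarrow> \<beta> \<le> t"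
    using compact_attains_inf[OF c(1)] z by blast
  obtain \<alpha> where \<alpha>: "\<alpha> \<in> spectrum4 \<inter> {..x}" "\<And>t. t \<in> spectrum4 \<inter> {..x} \<Longrightarrow> t \<le> \<alpha>"
    using compact_attains_sup[OF c(2)] y by blast
  have M: "\<alpha> \<in> markov_spectrum" "\<beta> \<in> markov_spectrum" using \<alpha> \<beta> spectrum4_subset by auto
  then have "\<alpha> \<noteq> x" "x \<noteq> \<beta>" using assms(1) by auto
  then have lt: "\<alpha> < x" "x < \<beta>" using \<alpha>(1) \<beta>(1) by auto
  have "\<beta> \<le> z" using \<beta>(2) z by blast
  have sub: "{\<alpha><..<\<beta>} \<subseteq> - markov_spectrum"
  proof
    fix t assume t: "t \<in> {\<alpha><..<\<beta>}"
    show "t \<in> - markov_spectrum"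
    proof
      assume "t \<in> markov_spectrum"
      then have "t \<in> spectrum4" using markov_spectrum_subset t \<open>\<beta> \<le> z\<close> assms by auto
      then show False using \<alpha>(2)[of t] \<beta>(2)[of t] t by (cases "t \<le> x") auto
    qed
  qed
  have "{\<alpha><..<\<beta>} \<in> components (- markov_spectrum)"
    unfolding in_components_maximal
  proof (intro conjI allI impI)
    show "{\<alpha><..<\<beta>} \<noteq> {}" using lt by auto
    show "{\<alpha><..<\<beta>} \<subseteq> - markov_spectrum" by fact
    show "connected {\<alpha><..<\<beta>}" by simp
    fix D assume D: "D \<noteq> {} \<and> {\<alpha><..<\<beta>} \<subseteq> D \<and> D \<subseteq> - markov_spectrum \<and> connected D"
    have x: "x \<in> D" using D lt by auto
    \<comment> \<open>A connected set is an interval, so reaching beyond an endpoint would put that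
      spectral endpoint into D.\<close>
    have "t \<in> {\<alpha><..<\<beta>}" if "t \<in> D" for t
    proof (rule ccontr)
      assume "t \<notin> {\<alpha><..<\<beta>}"
      then have "t \<le> \<alpha> \<or> \<beta> \<le> t" by auto
      then have "\<alpha> \<in> D \<or> \<beta> \<in> D"
        using connectedD_interval[of D t x \<alpha>] connectedD_interval[of D x t \<beta>] D x that lt by linarith
      then show False using D M by auto
    qed
    then show "D = {\<alpha><..<\<beta>}" using D by blast
  qed
  then have "maximal_gap {\<alpha><..<\<beta>}" by (simp add: maximal_gap_def)
  then show ?thesis using that lt \<open>\<beta> \<le> z\<close> by blast
qed

text \<open>Some spectral point to the left is needed for the gaps to be bounded; the constant
  sequence 1 has values at most 1 + 1 + 1.\<close>

lemma ex_spectrum_le_3: "\<exists>y \<in> markov_spectrum. y \<le> 3"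
proof -
  let ?a = "\<lambda>_::int. 1::nat"
  have p: "\<forall>i. 1 \<le> ?a i" by simp
  have "markov_lambda ?a j = markov_lambda ?a 0" for j
    using markov_lambda_translate[of ?a j 0] by simp
  then have "markov_sup ?a = ereal (markov_lambda ?a 0)" by (intro markov_supI) (rule eq_refl)
  moreover have "markov_lambda ?a 0 \<le> 3"
    using recip_le[OF zero_less_one cfrac_ge_1[OF pos_seq_sides(1)[OF p, of 0]]]
      recip_le[OF zero_less_one cfrac_ge_1[OF pos_seq_sides(2)[OF p, of 0]]]
    unfolding markov_lambda_eq[OF p] by simp
  ultimately show ?thesis using markov_spectrumI[OF p] by blast
qed

lemma gaps_tendsto:
  assumes z: "z \<in> markov_spectrum" "3 < z" "z < 5"
    and "\<And>e. 0 < e \<Longrightarrow> \<exists>x. x \<notin> markov_spectrum \<and> z - e < x \<and> x < z"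
  shows "\<exists>\<alpha> \<beta> :: nat \<Rightarrow> real. (\<forall>n. maximal_gap {\<alpha> n<..<\<beta> n}) \<and> \<beta> \<longlonglongrightarrow> z"
proof -
  have "\<exists>\<alpha> \<beta>. maximal_gap {\<alpha><..<\<beta>} \<and> z - 1 / Suc n < \<beta> \<and> \<beta> \<le> z" for n
  proof -
    \<comment> \<open>The minimum with z - 3 keeps x above 3, hence above the spectral point
      y.\<close>
    obtain x where x: "x \<notin> markov_spectrum" "z - min (1 / Suc n) (z - 3) < x" "x < z"
      using assms(4)[of "min (1 / Suc n) (z - 3)"] z by auto
    obtain y where "y \<in> markov_spectrum" "y \<le> 3" using ex_spectrum_le_3 by blast
    moreover have "z - (z - 3) < x" using x(2) by linarith
    ultimately obtain \<alpha> \<beta> where "maximal_gap {\<alpha><..<\<beta>}" "x < \<beta>" "\<beta> \<le> z"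
      using maximal_gap_above[OF x(1), of y z] x(3) z by (metis diff_diff_eq2 add.commute add_diff_cancel_right' le_less_trans)
    then show ?thesis using x by (intro exI[of _ \<alpha>] exI[of _ \<beta>]) auto
  qed
  then obtain \<alpha> \<beta> where ab: "\<And>n. maximal_gap {\<alpha> n<..<\<beta> n}"
    "\<And>n. z - 1 / Suc n < \<beta> n" "\<And>n. \<beta> n \<le> z" by metis
  have "(\<lambda>n. z - 1 / real (Suc n)) \<longlonglongrightarrow> z - 0"
    using LIMSEQ_inverse_real_of_nat by (intro tendsto_intros) (simp add: inverse_eq_divide)
  then have "\<beta> \<longlonglongrightarrow> z"
    using ab(2,3) by (intro tendsto_sandwich[of "\<lambda>n. z - 1 / real (Suc n)" \<beta> sequentially "\<lambda>_. z"])
      (auto intro!: always_eventually less_imp_le)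
  with ab(1) show ?thesis by blast
qed

section \<open>Maximal tails\<close>

lemma cf_fun_less:
  assumes "pos_seq s" "0 < y" "y < z"
  shows "even n \<Longrightarrow> cf_fun n s z < cf_fun n s y" "odd n \<Longrightarrow> cf_fun n s y < cf_fun n s z"
proof -
  note b = cf_den_bounds[OF assms(1), of n]
  define d where "d = (z - y) / ((cf_den s (Suc n) * y + cf_den s n) * (cf_den s (Suc n) * z + cf_den s n))"
  have "0 < d" unfolding d_def
    using b assms by (intro divide_pos_pos mult_pos_pos add_pos_nonneg) auto
  moreover have "cf_fun n s y - cf_fun n s z = (-1) ^ n * d"
    using cf_fun_diff[OF assms(1), of y z n] assms by (simp add: d_def)
  ultimately show "even n \<Longrightarrow> cf_fun n s z < cf_fun n s y" "odd n \<Longrightarrow> cf_fun n s y < cf_fun n s z"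
    by auto
qed

lemma cf_fun_mono:
  assumes "pos_seq s" "0 < y" "y \<le> z"
  shows "even n \<Longrightarrow> cf_fun n s z \<le> cf_fun n s y" "odd n \<Longrightarrow> cf_fun n s y \<le> cf_fun n s z"
  using cf_fun_less[OF assms(1,2), of z n] assms(3) by (cases "y = z"; force)+

lemma cf_fun_cong: "(\<And>i. i < n \<Longrightarrow> s i = t i) \<Longrightarrow> cf_fun n s y = cf_fun n t y"
  by (induction n arbitrary: y) auto

lemma cf_fun_bounds: "pos_seq s \<Longrightarrow> 1 \<le> y \<Longrightarrow> 0 < cf_fun n s y \<and> cf_fun n s y \<le> 1"
proof (induction n arbitrary: y)
  case (Suc n)
  have "1 \<le> real (s n)" using pos_seqD[OF Suc.prems(1), of n] by simp
  moreover have "0 < 1 / y" using Suc.prems by simp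
  ultimately have "1 \<le> real (s n) + 1 / y" by linarith
  then show ?case using Suc by simp
qed simp

text \<open>Collapses everything after index m into one complete quotient, as needed for a
  comparison at a first deviation m.\<close>

lemma cf_fun_split: "cf_fun (m + Suc k) s y = cf_fun m s (real (s m) + cf_fun k (shift (Suc m) s) y)"
  by (induction k arbitrary: y) simp_all

lemma cfrac_tail_bounds:
  assumes "pos_seq s"
  shows "real (s n) < cfrac (shift n s)" "cfrac (shift n s) \<le> real (s n) + 1"
proof -
  have e: "cfrac (shift n s) = real (s n) + 1 / cfrac (shift (Suc n) s)"
    using cfrac_unfold[OF pos_seq_shift[OF assms, of n]] by simp
  have "1 \<le> cfrac (shift (Suc n) s)" by (rule cfrac_ge_1[OF pos_seq_shift[OF assms]])
  then have "0 < 1 / cfrac (shift (Suc n) s)" "1 / cfrac (shift (Suc n) s) \<le> 1" by auto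
  then show "real (s n) < cfrac (shift n s)" "cfrac (shift n s) \<le> real (s n) + 1" using e by auto
qed

lemma cfrac_tail_bounds4:
  assumes "seq4 s"
  shows "real (s n) + 6 / 29 \<le> cfrac (shift n s)" "cfrac (shift n s) \<le> real (s n) + 5 / 6"
proof -
  have e: "cfrac (shift n s) = real (s n) + 1 / cfrac (shift (Suc n) s)"
    using cfrac_unfold[OF pos_seq_shift[OF seq4_pos[OF assms], of n]] by simp
  note b = cfrac_seq4[OF seq4_shift[OF assms, of "Suc n"]]
  have "1 / (29 / 6) \<le> 1 / cfrac (shift (Suc n) s)" "1 / cfrac (shift (Suc n) s) \<le> 1 / (6 / 5)"
    using b by (intro recip_le; linarith)+
  then show "real (s n) + 6 / 29 \<le> cfrac (shift n s)" "cfrac (shift n s) \<le> real (s n) + 5 / 6"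
    using e by auto
qed

text \<open>\<open>[0; s]\<close> decreases with the entries of even index and increases with those of odd index, so
  \<open>below s t\<close> says that the first deviation of \<open>t\<close> from \<open>s\<close> makes \<open>[0; t]\<close> smaller.\<close>

definition below :: "(nat \<Rightarrow> nat) \<Rightarrow> (nat \<Rightarrow> nat) \<Rightarrow> bool" where
  "below s t \<longleftrightarrow> (\<forall>m. (\<forall>i<m. t i = s i) \<longrightarrow> (if even m then s m \<le> t m else t m \<le> s m))"

lemma below_deviates:
  assumes "pos_seq s" "pos_seq t" "below s t" "\<not> (\<forall>i<n. t i = s i)" "1 \<le> y"
  shows "1 / cfrac t \<le> cf_fun n s y"
proof -
  define m where "m = (LEAST m. t m \<noteq> s m)"
  obtain i where i: "i < n" "t i \<noteq> s i" using assms(4) by blast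
  have m: "t m \<noteq> s m" "m \<le> i" 
    unfolding m_def using LeastI[of "\<lambda>m. t m \<noteq> s m" i] Least_le[of "\<lambda>m. t m \<noteq> s m" i] i(2) by auto
  have ag: "t k = s k" if "k < m" for k using that not_less_Least unfolding m_def by blast
  obtain k where k: "n = m + Suc k" using m(2) i(1) by (metis less_imp_Suc_add le_less_trans add_Suc_right)
  define y' where "y' = real (s m) + cf_fun k (shift (Suc m) s) y"
  have "0 < cf_fun k (shift (Suc m) s) y" "cf_fun k (shift (Suc m) s) y \<le> 1"
    using cf_fun_bounds[OF pos_seq_shift[OF assms(1), of "Suc m"] assms(5), of k] by auto
  then have y': "real (s m) \<le> y'" "y' \<le> real (s m) + 1" "0 < y'" unfolding y'_def by auto
  have "1 / cfrac t = cf_fun m s (cfrac (shift m t))"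
    using cf_fun_tail[OF assms(2), of m] cf_fun_cong[of m t s] ag by simp
  moreover have "cf_fun n s y = cf_fun m s y'" unfolding k y'_def by (rule cf_fun_split)
  moreover note tb = cfrac_tail_bounds[OF assms(2), of m]
  have "cf_fun m s (cfrac (shift m t)) \<le> cf_fun m s y'"
  proof (cases "even m")
    case True
    then have "s m < t m" using assms(3) ag m(1) unfolding below_def by (metis le_neq_implies_less)
    then have "real (s m) + 1 \<le> real (t m)" by simp
    then have "y' \<le> cfrac (shift m t)" using y' tb by linarith
    then show ?thesis using cf_fun_mono(1)[OF assms(1) y'(3)] True by blast
  next
    case False
    then have "t m < s m" using assms(3) ag m(1) unfolding below_def by (metis le_neq_implies_less)
    then have "real (t m) + 1 \<le> real (s m)" by simp
    then have "cfrac (shift m t) \<le> y'" "0 < cfrac (shift m t)" using y' tb by linarith+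
    then show ?thesis using cf_fun_mono(2)[OF assms(1)] False by blast
  qed
  ultimately show ?thesis by simp
qed

lemma below_le:
  assumes "pos_seq s" "pos_seq t" "below s t"
  shows "1 / cfrac t \<le> 1 / cfrac s"
proof (cases "t = s")
  case False
  then obtain i where i: "t i \<noteq> s i" by blast
  then have "\<not> (\<forall>k<Suc i. t k = s k)" by blast
  then have "1 / cfrac t \<le> cf_fun (Suc i) s (cfrac (shift (Suc i) s))"
    by (rule below_deviates[OF assms _ cfrac_ge_1[OF pos_seq_shift[OF assms(1)]]])
  then show ?thesis using cf_fun_tail[OF assms(1), of "Suc i"] by simp
qed simp

lemma agree_tail:
  assumes "pos_seq t" "\<forall>i<n. t i = s i"
  shows "1 / cfrac t = cf_fun n s (cfrac (shift n t))"
  using cf_fun_tail[OF assms(1), of n] cf_fun_cong[of n t s] assms(2) by simp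

section \<open>Forbidden words and the two tails of the limit\<close>

lemma window_rgt:
  assumes "length l \<le> n" "\<forall>i<length l. int (rgt a p (n - Suc i)) = l ! i" "int (rgt a p n) = c"
    "\<forall>i<length r. int (rgt a p (n + Suc i)) = r ! i"
  shows "window a (p + 1 + int n) l c r"
  unfolding window_def agrees_def
proof (intro conjI allI impI)
  show "int (a (p + 1 + int n)) = c" using assms(3) by (simp add: rgt_def)
  fix i assume i: "i < length l"
  then have "int (n - Suc i) = int n - 1 - int i" using assms(1) by (simp add: of_nat_diff)
  then have "lft a (p + 1 + int n) i = rgt a p (n - Suc i)"
    unfolding lft_def rgt_def by (intro arg_cong[of _ _ a]) linarith
  then show "int (lft a (p + 1 + int n) i) = l ! i" using assms(2) i by simp
next
  fix i assume i: "i < length r"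
  have "rgt a (p + 1 + int n) i = rgt a p (n + Suc i)"
    unfolding rgt_def by (intro arg_cong[of _ _ a]) linarith
  then show "int (rgt a (p + 1 + int n) i) = r ! i" using assms(4) i by simp
qed

text \<open>The bound lies just above \<open>\<nu>\<close> and is the threshold of the
  \<open>High\<close> and kill leaves.\<close>

definition near_nu :: "(int \<Rightarrow> nat) \<Rightarrow> bool" where
  "near_nu a \<longleftrightarrow> (\<forall>i. a i \<in> {1..4}) \<and> (\<forall>j. markov_lambda a j \<le> 4.52782953842)"

lemma forbidden:
  assumes "near_nu a" "length l \<le> n" "\<forall>i<length l. int (rgt a p (n - Suc i)) = l ! i"
    "int (rgt a p n) = c" "\<forall>i<length r. int (rgt a p (n + Suc i)) = r ! i"
    "lam_gt 452782953842 100000000000 l c r"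
  shows False
proof -
  have "452782953842 / 100000000000 < markov_lambda a (p + 1 + int n)"
    using lam_gt_sound[OF _ window_rgt[OF assms(2-5)] _ assms(6)] assms(1) by (simp add: near_nu_def)
  then show False using assms(1) unfolding near_nu_def by (simp add: not_less[symmetric])
qed

definition right_max :: "nat \<Rightarrow> nat" where
  "right_max = ev_periodic [3,1,3,1,2,1,1,3,3] [3,1,3,1,2,1]"

definition left_max :: "nat \<Rightarrow> nat" where
  "left_max = ev_periodic [3,1,3,1,3] [4,4,4,3,2,3]"

lemmas max_defs = right_max_def left_max_def ev_periodic_def

lemma ev_periodic_seq4: "set xs \<subseteq> {1..4} \<Longrightarrow> set ys \<subseteq> {1..4} \<Longrightarrow> ys \<noteq> [] \<Longrightarrow> seq4 (ev_periodic xs ys)"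
  unfolding seq4_def ev_periodic_def
  by (metis (no_types, lifting) length_greater_0_conv mod_less_divisor nth_mem subsetD)

lemma seq4_max: "seq4 right_max" "seq4 left_max"
  unfolding right_max_def left_max_def by (intro ev_periodic_seq4; simp)+

lemma less_6_cases: "(r::nat) < 6 \<Longrightarrow> r = 0 \<or> r = 1 \<or> r = 2 \<or> r = 3 \<or> r = 4 \<or> r = 5"
  by auto

lemma period_cases:
  assumes "c \<le> (m::nat)"
  obtains k r where "m = c + 6 * k + r" "r \<in> {0,1,2,3,4,5}"
proof
  show "m = c + 6 * ((m - c) div 6) + (m - c) mod 6" using assms by simp
  show "(m - c) mod 6 \<in> {0,1,2,3,4,5}" using less_6_cases[of "(m - c) mod 6"] by simp
qed

lemma rgt_near: "near_nu a \<Longrightarrow> rgt a p i \<in> {1..4}"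
  by (simp add: near_nu_def rgt_def)

lemma all_less_simps: "(\<forall>i<Suc n. P i) \<longleftrightarrow> P 0 \<and> (\<forall>i<n. P (Suc i))"
  using less_Suc_eq_0_disj by auto

text \<open>The first list is read leftwards from the centre. The first three words serve
  \<open>right_below\<close>, the others \<open>left_below\<close>; the fourth and fifth also serve
  \<open>no_small_after_4\<close>.\<close>

lemma forbidden_words:
  "lam_gt 452782953842 100000000000 [1,3,3,3] 3 [1,3]"
  "lam_gt 452782953842 100000000000 [1,3,1] 3 [1,3]"
  "lam_gt 452782953842 100000000000 [1] 4 []"
  "lam_gt 452782953842 100000000000 [] 4 [1]"
  "lam_gt 452782953842 100000000000 [] 4 [2]"
  "lam_gt 452782953842 100000000000 [3,2,3] 4 [1]"
  "lam_gt 452782953842 100000000000 [3,2,3] 4 [2]"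
  "lam_gt 452782953842 100000000000 [3,2,3] 4 [3]"
  "lam_gt 452782953842 100000000000 [4,4] 4 [3,3]"
  "lam_gt 452782953842 100000000000 [4,4] 4 [3,4]"
  "lam_gt 452782953842 100000000000 [4,4,3] 4 [3,2,1]"
  "lam_gt 452782953842 100000000000 [4,4,3] 4 [3,2,2]"
  by (simp_all add: lam_gt_def)

text \<open>From index 10 on, \<open>right_max\<close> has its least possible letter 1 at even
  indices, so only odd indices matter. There a 4 is excluded because it would follow a 1, and a 3 in
  place of the 2 creates one of the first two forbidden words.\<close>

lemma right_below:
  assumes a: "near_nu a" and "agrees [3,1,3,1,2,1,1,3,3,3] (rgt a p)"
  shows "below right_max (rgt a p)"
  unfolding below_def
proof (intro allI impI)
  fix m assume ag: "\<forall>i<m. rgt a p i = right_max i"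
  let ?t = "rgt a p"
  have t4: "?t m \<in> {1..4}" by (rule rgt_near[OF a])
  show "if even m then right_max m \<le> ?t m else ?t m \<le> right_max m"
  proof (cases "m < 10")
    case True
    have "?t i = right_max i" if "i < 10" for i
    proof -
      have "i \<in> {0,1,2,3,4,5,6,7,8,9}" unfolding insert_iff empty_iff using that by presburger
      moreover have "int (?t i) = [3,1,3,1,2,1,1,3,3,3] ! i"
        using assms(2) that unfolding agrees_def by simp
      ultimately show ?thesis
        by (elim insertE emptyE) (simp_all add: max_defs)
    qed
    then show ?thesis using True by simp
  next
    case False
    \<comment> \<open>Index 9 is preceded by 3 instead of 1, so the argument against 4 fails there;
      this is why the assumed word has ten letters.\<close>
    then obtain k r where m: "m = 9 + 6 * k + r" and r: "r \<in> {0,1,2,3,4,5}" "10 \<le> 9 + 6 * k + r"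
      using period_cases[of 9 m] by auto
    have S: "right_max m = [3,1,3,1,2,1] ! r"
      using r(1) by (auto simp: m max_defs)
    have no14: "?t m \<noteq> 4" if "?t (m - 1) = 1"
    proof
      assume "?t m = 4"
      then show False using forbidden[OF a, of "[1]" m p 4 "[]"] that m r forbidden_words(3)
        by (simp add: all_less_simps)
    qed
    have prev: "?t (m - 1) = right_max (m - 1)" using ag m r by auto
    \<comment> \<open>The first 2 of the period is treated apart, since the letters before it still
      belong to the preperiod 1,1,3,3.\<close>
    consider "r = 0" "k \<ge> 1" | "r \<in> {1,3,5}" | "r = 2" | "r = 4" "k = 0" | k' where "r = 4" "k = Suc k'"
      using r by (cases k) auto
    then show ?thesis
    proof cases
      case 1
      then obtain k' where k': "k = Suc k'" by (cases k) auto
      have "?t (m - 1) = 1" unfolding prev using m 1 k' by (simp add: max_defs)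
      then show ?thesis using no14 t4 S m 1 by auto
    next
      case 2
      then show ?thesis using t4 S m by auto
    next
      case 3
      have "?t (m - 1) = 1" unfolding prev using m 3 by (simp add: max_defs)
      then show ?thesis using no14 t4 S m 3 by auto
    next
      case 4
      have "?t (m - 1) = 1" unfolding prev using m 4 by (simp add: max_defs)
      then have "?t m \<noteq> 4" by (rule no14)
      moreover have "?t m \<noteq> 3"
      proof
        assume "?t m = 3"
        moreover have "?t 12 = 1" "?t 11 = 3" "?t 10 = 1" "?t 9 = 3" "?t 8 = 3" "?t 7 = 3"
          using ag m 4 by (simp_all add: max_defs)
        ultimately show False
          using forbidden[OF a, of "[1,3,3,3]" 11 p 3 "[1,3]"] m 4 forbidden_words(1)
          by (simp add: all_less_simps)
      qed
      ultimately show ?thesis using t4 S m 4 by auto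
    next
      case 5
      have "?t (m - 1) = 1" unfolding prev using m 5 by (simp add: max_defs)
      then have "?t m \<noteq> 4" by (rule no14)
      moreover have "?t m \<noteq> 3"
      proof
        assume "?t m = 3"
        moreover have "?t (18 + 6 * k') = 1" "?t (17 + 6 * k') = 3" "?t (16 + 6 * k') = 1"
          "?t (15 + 6 * k') = 3" "?t (14 + 6 * k') = 1"
          using ag m 5 by (simp_all add: max_defs)
        ultimately show False
          using forbidden[OF a, of "[1,3,1]" "17 + 6 * k'" p 3 "[1,3]"] m 5 forbidden_words(2)
          by (simp add: all_less_simps)
      qed
      ultimately show ?thesis using t4 S m 5 by auto
    qed
  qed
qed

text \<open>The assumed word covers the preperiod and one full period 4,4,4,3,2,3, so every later
  index has a full period before it. The first and third 4 are maximal at odd indices; each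
  remaining letter of the period is protected by forbidden words.\<close>

lemma left_below:
  assumes a: "near_nu a" and "agrees [3,1,3,1,3,4,4,4,3,2,3] (rgt a p)"
  shows "below left_max (rgt a p)"
  unfolding below_def
proof (intro allI impI)
  fix m assume ag: "\<forall>i<m. rgt a p i = left_max i"
  let ?t = "rgt a p"
  have t4: "?t m \<in> {1..4}" by (rule rgt_near[OF a])
  show "if even m then left_max m \<le> ?t m else ?t m \<le> left_max m"
  proof (cases "m < 11")
    case True
    have "?t i = left_max i" if "i < 11" for i
    proof -
      have "i \<in> {0,1,2,3,4,5,6,7,8,9,10}" unfolding insert_iff empty_iff using that by presburger
      moreover have "int (?t i) = [3,1,3,1,3,4,4,4,3,2,3] ! i"
        using assms(2) that unfolding agrees_def by simp
      ultimately show ?thesis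
        by (elim insertE emptyE) (simp_all add: max_defs)
    qed
    then show ?thesis using True by simp
  next
    case False
    then obtain k r where m: "m = 11 + 6 * k + r" and r: "r \<in> {0,1,2,3,4,5}"
      using period_cases[of 11 m] by auto
    have S: "left_max m = [4,4,4,3,2,3] ! r"
      using r by (auto simp: m max_defs)
    consider "r \<in> {0,2}" | "r = 1" | "r = 3" | "r = 4" | "r = 5"
      using r by auto
    then show ?thesis
    proof cases
      case 1
      then show ?thesis using t4 S m by auto
    next
      case 2
      have v: "?t (11 + 6 * k) = 4" "?t (10 + 6 * k) = 3" "?t (9 + 6 * k) = 2" "?t (8 + 6 * k) = 3"
        using ag m 2 by (simp_all add: max_defs)
      have "?t m \<noteq> 1" "?t m \<noteq> 2" "?t m \<noteq> 3"
        using forbidden[OF a, of "[3,2,3]" "11 + 6 * k" p 4 "[1]"]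
          forbidden[OF a, of "[3,2,3]" "11 + 6 * k" p 4 "[2]"]
          forbidden[OF a, of "[3,2,3]" "11 + 6 * k" p 4 "[3]"] v m 2 forbidden_words(6-8)
        by (auto simp: all_less_simps)
      then show ?thesis using t4 S m 2 by auto
    next
      case 3
      have v: "?t (13 + 6 * k) = 4" using ag m 3 by (simp_all add: max_defs)
      have "?t m \<noteq> 1" "?t m \<noteq> 2"
        using forbidden[OF a, of "[]" "13 + 6 * k" p 4 "[1]"]
          forbidden[OF a, of "[]" "13 + 6 * k" p 4 "[2]"] v m 3 forbidden_words(4-5)
        by (auto simp: all_less_simps)
      then show ?thesis using t4 S m 3 by auto
    next
      case 4
      have v: "?t (14 + 6 * k) = 3" "?t (13 + 6 * k) = 4" "?t (12 + 6 * k) = 4" "?t (11 + 6 * k) = 4"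
        using ag m 4 by (simp_all add: max_defs)
      have "?t m \<noteq> 3" "?t m \<noteq> 4"
        using forbidden[OF a, of "[4,4]" "13 + 6 * k" p 4 "[3,3]"]
          forbidden[OF a, of "[4,4]" "13 + 6 * k" p 4 "[3,4]"] v m 4 forbidden_words(9-10)
        by (auto simp: all_less_simps)
      then show ?thesis using t4 S m 4 by auto
    next
      case 5
      have v: "?t (15 + 6 * k) = 2" "?t (14 + 6 * k) = 3" "?t (13 + 6 * k) = 4" "?t (12 + 6 * k) = 4"
        "?t (11 + 6 * k) = 4" "?t (10 + 6 * k) = 3"
        using ag m 5 by (simp_all add: max_defs)
      have "?t m \<noteq> 1" "?t m \<noteq> 2"
        using forbidden[OF a, of "[4,4,3]" "13 + 6 * k" p 4 "[3,2,1]"]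
          forbidden[OF a, of "[4,4,3]" "13 + 6 * k" p 4 "[3,2,2]"] v m 5 forbidden_words(11-12)
        by (auto simp: all_less_simps)
      then show ?thesis using t4 S m 5 by auto
    qed
  qed
qed

lemma no_small_after_4:
  assumes "near_nu a" "rgt a p n = 4"
  shows "3 \<le> rgt a p (Suc n)"
  using forbidden[OF assms(1), of "[]" n p 4 "[1]"] forbidden[OF assms(1), of "[]" n p 4 "[2]"]
    rgt_near[OF assms(1), of p "Suc n"] assms(2) forbidden_words(4,5)
  by (force simp: all_less_simps)

section \<open>Gaps between the deviations\<close>

lemma left_max_4: "left_max (11 + 6 * k) = 4" "left_max (12 + 6 * k) = 4" "left_max (13 + 6 * k) = 4"
  by (simp_all add: max_defs)

text \<open>Two letters 4 followed by z in [16/5, 29/6] confine the complete quotient to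
  [292/69, 517/122].\<close>

lemma recip_444:
  assumes "seq4 t" "t n = 4" "t (Suc n) = 4" "3 \<le> t (Suc (Suc n))"
  shows "122 / 517 \<le> 1 / cfrac (shift n t)" "1 / cfrac (shift n t) \<le> 69 / 292"
proof -
  define x y z where "x = cfrac (shift n t)" and "y = cfrac (shift (Suc n) t)"
    and "z = cfrac (shift (Suc (Suc n)) t)"
  have e: "x = 4 + 1 / y" "y = 4 + 1 / z"
    using cfrac_unfold[OF pos_seq_shift[OF seq4_pos[OF assms(1)], of n]]
      cfrac_unfold[OF pos_seq_shift[OF seq4_pos[OF assms(1)], of "Suc n"]] assms(2,3)
    by (simp_all add: x_def y_def z_def)
  have "real 3 \<le> real (t (Suc (Suc n)))" using assms(4) by (simp only: of_nat_le_iff)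
  then have z: "16 / 5 \<le> z" "z \<le> 29 / 6"
    using cfrac_tail_bounds4(1)[OF assms(1), of "Suc (Suc n)"]
      cfrac_seq4(2)[OF seq4_shift[OF assms(1), of "Suc (Suc n)"]] by (simp_all add: z_def)
  have "1 / (29 / 6) \<le> 1 / z" "1 / z \<le> 1 / (16 / 5)" using z by (intro recip_le; linarith)+
  then have y: "122 / 29 \<le> y" "y \<le> 69 / 16" using e(2) by auto
  have "1 / (69 / 16) \<le> 1 / y" "1 / y \<le> 1 / (122 / 29)" using y by (intro recip_le; linarith)+
  then have x: "292 / 69 \<le> x" "x \<le> 517 / 122" using e(1) by auto
  have "1 / (517 / 122) \<le> 1 / x" "1 / x \<le> 1 / (292 / 69)" using x by (intro recip_le; linarith)+
  then show "122 / 517 \<le> 1 / cfrac (shift n t)" "1 / cfrac (shift n t) \<le> 69 / 292"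
    by (simp_all add: x_def)
qed

text \<open>Denominator of the convergent that ends just before a block 4,4,4; its inverse square is
  the scale of level k.\<close>

definition left_den :: "nat \<Rightarrow> real" where
  "left_den k = cf_den left_max (12 + 6 * k)"

text \<open>If t leaves \<open>left_max\<close> no later than the first 4 of the block, the loss is
  large. Otherwise the second 4 is forced as well and the third letter is at least 3, so
  \<open>recip_444\<close> confines both quotients to the same short interval.\<close>

lemma left_gap:
  assumes "seq4 t" "below left_max t" and three: "\<And>n. t n = 4 \<Longrightarrow> 3 \<le> t (Suc n)"
  shows "11 / 754 / (left_den k)\<^sup>2 \<le> 1 / cfrac left_max - 1 / cfrac t \<or>
    1 / cfrac left_max - 1 / cfrac t \<le> 49 / 150964 / (left_den k)\<^sup>2"
proof -
  define n where "n = 11 + 6 * k"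
  define q where "q = left_den k"
  have q: "cf_den left_max (Suc n) = q" by (simp add: n_def q_def left_den_def)
  have "odd n" by (simp add: n_def)
  have S: "left_max n = 4" "left_max (Suc n) = 4" "left_max (Suc (Suc n)) = 4"
    using left_max_4[of k] by (simp_all add: n_def)
  note s = seq4_max(2)
  note sp = seq4_pos[OF s] and tp = seq4_pos[OF assms(1)]
  define y where "y = cfrac (shift n left_max)"
  define x where "x = cfrac (shift n t)"
  have gs: "1 / cfrac left_max = cf_fun n left_max y" unfolding y_def by (rule cf_fun_tail[OF sp])
  have ry: "122 / 517 \<le> 1 / y" "1 / y \<le> 69 / 292"
    using recip_444[OF s S(1,2)] S(3) by (simp_all add: y_def)
  have y: "4 + 6 / 29 \<le> y" using cfrac_tail_bounds4(1)[OF s, of n] S by (simp add: y_def)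
  show ?thesis
  proof (cases "\<forall>i<Suc n. t i = left_max i")
    case False
    \<comment> \<open>A letter at most 3 at index n leaves a complete quotient of at most 3 + 5/6 =
      23/6.\<close>
    have "1 / cfrac t \<le> cf_fun n left_max (23 / 6)"
    proof (cases "\<forall>i<n. t i = left_max i")
      case True
      then have "t n \<noteq> left_max n" using False less_Suc_eq by auto
      moreover have "t n \<le> left_max n" using True assms(2) \<open>odd n\<close> unfolding below_def by presburger
      ultimately have "t n \<le> 3" using S by simp
      then have "real (t n) \<le> 3" by simp
      then have "x \<le> 23 / 6" using cfrac_tail_bounds4(2)[OF assms(1), of n] by (simp add: x_def)
      moreover have "0 < x" using cfrac_seq4(1)[OF seq4_shift[OF assms(1), of n]] by (simp add: x_def)
      ultimately show ?thesis
        using cf_fun_mono(2)[OF sp, of x "23 / 6" n] \<open>odd n\<close> agree_tail[OF tp True] by (simp add: x_def)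
    qed (use below_deviates[OF sp tp assms(2), of n "23 / 6"] in simp)
    moreover have "11 / 754 / q\<^sup>2 \<le> cf_fun n left_max y - cf_fun n left_max (23 / 6)"
    proof -
      have "1 / (y + 1) \<le> 1 / (26 / 5)" using y by (intro recip_le) auto
      \<comment> \<open>Here 11/754 = 6/29 - 5/26.\<close>
      then have "11 / 754 \<le> \<bar>1 / (y + 1) - 1 / (23 / 6 + 1)\<bar>" by (simp add: abs_if)
      then have "11 / 754 / q\<^sup>2 \<le> \<bar>1 / (y + 1) - 1 / (23 / 6 + 1)\<bar> / q\<^sup>2"
        by (intro divide_right_mono) auto
      also have "\<dots> \<le> \<bar>cf_fun n left_max y - cf_fun n left_max (23 / 6)\<bar>"
        using cf_fun_abs_ge[OF sp, of y "23 / 6" n] y q by simp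
      also have "\<dots> = cf_fun n left_max y - cf_fun n left_max (23 / 6)"
        using cf_fun_mono(2)[OF sp, of "23 / 6" y n] \<open>odd n\<close> y by simp
      finally show ?thesis .
    qed
    ultimately show ?thesis unfolding gs q_def by linarith
  next
    case True
    then have "t n = 4" using S by simp
    have "left_max (Suc n) \<le> t (Suc n)" using True assms(2) \<open>odd n\<close> unfolding below_def by (metis even_Suc)
    moreover have "t (Suc n) \<le> 4" using assms(1) by (simp add: seq4_def)
    ultimately have t1: "t (Suc n) = 4" using S by simp
    have "122 / 517 \<le> 1 / x" "1 / x \<le> 69 / 292"
      using recip_444[OF assms(1) \<open>t n = 4\<close> t1 three[OF t1]] by (simp_all add: x_def)
    \<comment> \<open>The constant is the length 69/292 - 122/517 of the interval in
      \<open>recip_444\<close>.\<close>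
    then have "\<bar>1 / y - 1 / x\<bar> \<le> 49 / 150964" using ry by linarith
    then have "\<bar>1 / y - 1 / x\<bar> / q\<^sup>2 \<le> 49 / 150964 / q\<^sup>2" by (intro divide_right_mono) auto
    moreover have "0 < x" using cfrac_seq4(1)[OF seq4_shift[OF assms(1), of n]] by (simp add: x_def)
    then have "\<bar>cf_fun n left_max y - cf_fun n left_max x\<bar> \<le> \<bar>1 / y - 1 / x\<bar> / q\<^sup>2"
      using cf_fun_abs_le[OF sp, of y x n] y q by simp
    moreover have "1 / cfrac t = cf_fun n left_max x"
      using agree_tail[OF tp, of n left_max] True by (simp add: x_def)
    ultimately show ?thesis unfolding gs q_def by linarith
  qed
qed

section \<open>Gaps between the deviations of the right tail\<close>

definition inner_edge :: "nat \<Rightarrow> real" where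
  "inner_edge n = (if even n then 11 / 6 else real (right_max n) + 6 / 29)"

text \<open>Both edges are bounds for the complete quotient at index n: \<open>inner_edge\<close>
  when the letter is that of \<open>right_max\<close>, \<open>outer_edge\<close> when it is off by
  one in the admissible direction. At even indices that letter is 1, whence 1 + 5/6 and 2 +
  6/29.\<close>

definition outer_edge :: "nat \<Rightarrow> real" where
  "outer_edge n = (if even n then 64 / 29 else real (right_max n) - 1 / 6)"

lemma right_max_cases:
  assumes "10 \<le> n"
  shows "even n \<and> right_max n = 1 \<or> odd n \<and> right_max n \<in> {2, 3}"
proof -
  obtain k r where "n = 9 + 6 * k + r" "r \<in> {0,1,2,3,4,5}" using period_cases[of 9 n] assms by auto
  then show ?thesis by (auto simp: max_defs)
qed

text \<open>Sequences that deviate before n fall below the gap by \<open>below_deviates\<close>; the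
  others are sorted by whether their letter at n is that of \<open>right_max\<close>.\<close>

lemma right_gap:
  assumes "seq4 t" "below right_max t" "10 \<le> n"
  shows "1 / cfrac t \<le> cf_fun n right_max (outer_edge n) \<or> cf_fun n right_max (inner_edge n) \<le> 1 / cfrac t"
proof -
  note sp = seq4_pos[OF seq4_max(1)] and tp = seq4_pos[OF assms(1)]
  define x where "x = cfrac (shift n t)"
  have x: "real (t n) + 6 / 29 \<le> x" "x \<le> real (t n) + 5 / 6"
    using cfrac_tail_bounds4[OF assms(1), of n] by (simp_all add: x_def)
  have x0: "0 < x" using cfrac_seq4(1)[OF seq4_shift[OF assms(1), of n]] by (simp add: x_def)
  have edge: "1 \<le> outer_edge n" "0 < inner_edge n"
    using right_max_cases[OF assms(3)] by (auto simp: outer_edge_def inner_edge_def)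
  show ?thesis
  proof (cases "\<forall>i<n. t i = right_max i")
    case True
    have gt: "1 / cfrac t = cf_fun n right_max x" using agree_tail[OF tp True] by (simp add: x_def)
    have le: "if even n then right_max n \<le> t n else t n \<le> right_max n"
      using True assms(2) unfolding below_def by blast
    show ?thesis
    proof (cases "even n")
      case True
      then have S: "right_max n = 1" using right_max_cases[OF assms(3)] by auto
      consider "t n = 1" | "2 \<le> t n" using le S True by fastforce
      then show ?thesis
      proof cases
        case 1
        then have "x \<le> inner_edge n" using x True by (simp add: inner_edge_def)
        then show ?thesis using cf_fun_mono(1)[OF sp x0] True gt by simp
      next
        case 2
        then have "real 2 \<le> real (t n)" by (simp only: of_nat_le_iff)
        then have "outer_edge n \<le> x" using x True by (simp add: outer_edge_def)
        then show ?thesis using cf_fun_mono(1)[OF sp, of "outer_edge n" x n] edge True gt by simp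
      qed
    next
      case False
      consider "t n = right_max n" | "Suc (t n) \<le> right_max n" using le False by fastforce
      then show ?thesis
      proof cases
        case 1
        then have "inner_edge n \<le> x" using x False by (simp add: inner_edge_def)
        then show ?thesis using cf_fun_mono(2)[OF sp edge(2)] False gt by simp
      next
        case 2
        then have "real (Suc (t n)) \<le> real (right_max n)" by (simp only: of_nat_le_iff)
        then have "x \<le> outer_edge n" using x False by (simp add: outer_edge_def)
        then show ?thesis using cf_fun_mono(2)[OF sp x0] False gt by simp
      qed
    qed
  qed (use below_deviates[OF sp tp assms(2), of n "outer_edge n"] edge in simp)
qed

text \<open>The worst case is the letter 3, where 6/23 - 29/122 = 65/2806.\<close>

lemma right_gap_size:
  assumes "10 \<le> n"
  shows "65 / 2806 / (cf_den right_max (Suc n))\<^sup>2 \<le>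
    cf_fun n right_max (inner_edge n) - cf_fun n right_max (outer_edge n)"
proof -
  note sp = seq4_pos[OF seq4_max(1)]
  let ?q = "cf_den right_max (Suc n)" and ?i = "inner_edge n" and ?o = "outer_edge n"
  have pos: "0 < ?i" "0 < ?o" and c: "65 / 2806 \<le> \<bar>1 / (?i + 1) - 1 / (?o + 1)\<bar>"
    and le: "even n \<Longrightarrow> ?i \<le> ?o" "odd n \<Longrightarrow> ?o \<le> ?i"
    using right_max_cases[OF assms] by (auto simp: outer_edge_def inner_edge_def abs_if)
  have "65 / 2806 / ?q\<^sup>2 \<le> \<bar>1 / (?i + 1) - 1 / (?o + 1)\<bar> / ?q\<^sup>2"
    using c by (intro divide_right_mono) auto
  also have "\<dots> \<le> \<bar>cf_fun n right_max ?i - cf_fun n right_max ?o\<bar>"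
    by (rule cf_fun_abs_ge[OF sp pos])
  also have "\<dots> = cf_fun n right_max ?i - cf_fun n right_max ?o"
    using cf_fun_mono[OF sp pos(1), of ?o n] cf_fun_mono[OF sp pos(2), of ?i n] le
    by (cases "even n") auto
  finally show ?thesis .
qed

text \<open>Distance from the maximal right tail down to the upper end of the gap at index
  n.\<close>

definition right_dist :: "nat \<Rightarrow> real" where
  "right_dist n = 1 / cfrac right_max - cf_fun n right_max (inner_edge n)"

text \<open>Strictness comes from looking two entries further: the letters there lie in {1, 2, 3},
  so the extreme remainders 6/5 and 29/6 are not reached.\<close>

lemma right_dist_pos:
  assumes "10 \<le> n"
  shows "0 < right_dist n"
proof -
  note sp = seq4_pos[OF seq4_max(1)]
  define y where "y = cfrac (shift n right_max)"
  have y: "real (right_max n) < y" "y \<le> real (right_max n) + 5 / 6" "real (right_max n) + 6 / 29 \<le> y"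
    using cfrac_tail_bounds4[OF seq4_max(1), of n] cfrac_tail_bounds(1)[OF sp, of n] by (simp_all add: y_def)
  have e: "y = real (right_max n) + 1 / cfrac (shift (Suc n) right_max)"
    using cfrac_unfold[OF pos_seq_shift[OF sp, of n]] by (simp add: y_def)
  have gs: "1 / cfrac right_max = cf_fun n right_max y" unfolding y_def by (rule cf_fun_tail[OF sp])
  define z where "z = cfrac (shift (Suc n) right_max)"
  have z: "6 / 5 < z" "z < 29 / 6"
  proof -
    note c = right_max_cases[OF assms] right_max_cases[of "Suc n"] right_max_cases[of "Suc (Suc n)"]
    define w where "w = cfrac (shift (Suc (Suc n)) right_max)"
    have "z = real (right_max (Suc n)) + 1 / w"
      using cfrac_unfold[OF pos_seq_shift[OF sp, of "Suc n"]] by (simp add: z_def w_def)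
    moreover have w: "real (right_max (Suc (Suc n))) + 6 / 29 \<le> w" "w \<le> real (right_max (Suc (Suc n))) + 5 / 6"
      using cfrac_tail_bounds4[OF seq4_max(1), of "Suc (Suc n)"] by (simp_all add: w_def)
    moreover have w1: "6 / 5 < w" "w < 29 / 6" using w c assms by auto
    moreover have "1 / (29 / 6) < 1 / w" "1 / w < 1 / (6 / 5)"
      using w1 by (intro divide_strict_left_mono; simp)+
    ultimately show "6 / 5 < z" "z < 29 / 6" using c assms by auto
  qed
  have "1 / (29 / 6) < 1 / z" "1 / z < 1 / (6 / 5)"
    using z by (intro divide_strict_left_mono; simp)+
  then have ee: "even n \<Longrightarrow> y < inner_edge n" "odd n \<Longrightarrow> inner_edge n < y"
    using e right_max_cases[OF assms] by (auto simp: inner_edge_def z_def)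
  have "0 < y" "0 < inner_edge n" using y right_max_cases[OF assms] by (auto simp: inner_edge_def)
  then show ?thesis
    using cf_fun_less[OF sp, of y "inner_edge n" n] cf_fun_less[OF sp, of "inner_edge n" y n] ee
    by (cases "even n") (auto simp: right_dist_def gs)
qed

text \<open>The inner edge is the letter of \<open>right_max\<close> followed by an extreme
  remainder, so both values agree through index n and the next denominator applies. The constant is
  109/174 = 5/6 - 6/29.\<close>

lemma right_dist_le:
  assumes "10 \<le> n"
  shows "right_dist n \<le> 109 / 174 / (cf_den right_max (Suc (Suc n)))\<^sup>2"
proof -
  note sp = seq4_pos[OF seq4_max(1)]
  define e :: real where "e = (if even n then 6 / 5 else 29 / 6)"
  have "inner_edge n = real (right_max n) + 1 / e"
    using right_max_cases[OF assms] by (auto simp: inner_edge_def e_def)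
  then have ie: "cf_fun n right_max (inner_edge n) = cf_fun (Suc n) right_max e" by simp
  define y where "y = cfrac (shift (Suc n) right_max)"
  have y: "6 / 5 \<le> y" "y \<le> 29 / 6"
    using cfrac_seq4[OF seq4_shift[OF seq4_max(1), of "Suc n"]] by (simp_all add: y_def)
  then have "1 / (29 / 6) \<le> 1 / y" "1 / y \<le> 1 / (6 / 5)" by (intro recip_le; linarith)+
  then have "\<bar>1 / y - 1 / e\<bar> \<le> 109 / 174" by (auto simp: e_def abs_le_iff)
  then have "\<bar>1 / y - 1 / e\<bar> / (cf_den right_max (Suc (Suc n)))\<^sup>2 \<le> 109 / 174 / (cf_den right_max (Suc (Suc n)))\<^sup>2"
    by (intro divide_right_mono) auto
  moreover have "\<bar>cf_fun (Suc n) right_max y - cf_fun (Suc n) right_max e\<bar>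
      \<le> \<bar>1 / y - 1 / e\<bar> / (cf_den right_max (Suc (Suc n)))\<^sup>2"
    using y by (intro cf_fun_abs_le[OF sp]) (auto simp: e_def)
  moreover have "1 / cfrac right_max = cf_fun (Suc n) right_max y"
    unfolding y_def by (rule cf_fun_tail[OF sp])
  ultimately show ?thesis unfolding right_dist_def ie by linarith
qed

lemma recip_den_sq_le:
  assumes "pos_seq s" "0 < n"
  shows "1 / (cf_den s (Suc n))\<^sup>2 \<le> 1 / real n"
proof -
  note b = cf_den_bounds[OF assms(1), of n]
  have "real n * 1 \<le> cf_den s (Suc n) * cf_den s (Suc n)"
    using b by (intro mult_mono) auto
  then show ?thesis using assms(2) by (intro recip_le) (auto simp: power2_eq_square)
qed

text \<open>The window between the left deviations at level \<open>k\<close> is so wide that it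
  contains a gap on the right which is wider than the left deviations below the window.\<close>

lemma ex_common_gap:
  assumes "0 < e"
  shows "\<exists>k n t. 10 \<le> n \<and> 0 < t \<and> t < e \<and> 49 / 150964 / (left_den k)\<^sup>2 + right_dist n < t \<and>
    t < 11 / 754 / (left_den k)\<^sup>2 \<and>
    t < 1 / cfrac right_max - cf_fun n right_max (outer_edge n)"
proof -
  note sp = seq4_pos[OF seq4_max(1)] and lp = seq4_pos[OF seq4_max(2)]
  \<comment> \<open>The bound e makes t small; the bound \<open>right_dist 10\<close> prevents the
    index n chosen below from being 10, so that its predecessor is still admissible.\<close>
  define d where "d = min e (right_dist 10)"
  have "0 < d" using assms right_dist_pos[of 10] by (simp add: d_def)
  then obtain k where k: "1 / real (Suc k) < d" using nat_approx_posE by blast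
  define q where "q = 1 / (left_den k)\<^sup>2"
  define U where "U = 49 / 150964 * q"
  define V where "V = 11 / 754 * q"
  have "1 \<le> left_den k"
    using cf_den_bounds(2)[OF lp, of "11 + 6 * k"] by (simp add: left_den_def)
  then have q0: "0 < q" by (simp add: q_def)
  have "q \<le> 1 / real (11 + 6 * k)"
    using recip_den_sq_le[OF lp, of "11 + 6 * k"] by (simp add: q_def left_den_def)
  also have "\<dots> \<le> 1 / real (Suc k)" by (intro recip_le) auto
  finally have qd: "q < d" using k by simp
  define W where "W = V - U"
  \<comment> \<open>The factor 29 suffices because 109/174/29 < 65/2806.\<close>
  have W: "W > 29 * U" "U > 0" using q0 by (simp_all add: W_def U_def V_def)
  have "\<exists>n\<ge>10. right_dist n < W"
  proof -
    obtain N where N: "1 / real (Suc N) < W" using nat_approx_posE[of W] W by auto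
    have "right_dist (N + 10) \<le> 109 / 174 / (cf_den right_max (Suc (Suc (N + 10))))\<^sup>2"
      by (rule right_dist_le) simp
    also have "\<dots> \<le> 1 / (cf_den right_max (Suc (Suc (N + 10))))\<^sup>2" by (intro divide_right_mono) auto
    also have "\<dots> \<le> 1 / real (Suc (N + 10))" by (intro recip_den_sq_le[OF sp]) simp
    also have "\<dots> \<le> 1 / real (Suc N)" by (intro recip_le) auto
    finally show ?thesis using N by (intro exI[of _ "N + 10"]) auto
  qed
  then obtain n where n: "10 \<le> n" "right_dist n < W"
    and least: "\<And>m. 10 \<le> m \<Longrightarrow> m < n \<Longrightarrow> \<not> right_dist m < W"
    using exists_least_iff[of "\<lambda>n. 10 \<le> n \<and> right_dist n < W"] by blast
  have "n \<noteq> 10" using n(2) qd W q0 by (auto simp: d_def W_def V_def U_def)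
  then obtain m where m: "n = Suc m" "10 \<le> m" using n(1) by (cases n) auto
  define Q where "Q = 1 / (cf_den right_max (Suc n))\<^sup>2"
  \<comment> \<open>By minimality of n its predecessor is still at distance at least W. This bounds
    W by the scale Q, which also bounds the size of the gap at n from below.\<close>
  have "W \<le> right_dist m" using least m by (meson lessI not_less)
  then have "W \<le> 109 / 174 * Q" using right_dist_le[OF m(2)] by (simp add: m(1) Q_def)
  moreover have "65 / 2806 * Q \<le> cf_fun n right_max (inner_edge n) - cf_fun n right_max (outer_edge n)"
    using right_gap_size[OF n(1)] by (simp add: Q_def)
  ultimately have gap: "U < cf_fun n right_max (inner_edge n) - cf_fun n right_max (outer_edge n)"
    using W by linarith
  define hi where "hi = min V (1 / cfrac right_max - cf_fun n right_max (outer_edge n))"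
  have lo: "U + right_dist n < hi"
    using gap n(2) by (auto simp: hi_def right_dist_def W_def)
  \<comment> \<open>Midpoint of the part of the right gap, shifted by U, that lies below V.\<close>
  define t where "t = (U + right_dist n + hi) / 2"
  have t: "U + right_dist n < t" "t < hi" using lo by (simp_all add: t_def)
  have "t < V" "t < 1 / cfrac right_max - cf_fun n right_max (outer_edge n)"
    using t(2) by (simp_all add: hi_def)
  moreover have "0 < t" using t(1) right_dist_pos[OF n(1)] W(2) by linarith
  moreover have "t < e" using \<open>t < V\<close> qd q0 by (simp add: V_def d_def)
  moreover have "U = 49 / 150964 / (left_den k)\<^sup>2" "V = 11 / 754 / (left_den k)\<^sup>2"
    by (simp_all add: U_def V_def q_def)
  ultimately show ?thesis using n(1) t(1) by (intro exI[of _ k] exI[of _ n] exI[of _ t]) auto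
qed

section \<open>The central word\<close>

text \<open>Found by a greedy computer search.\<close>

definition cert4 :: cert where
  "cert4 =
    Extend_right High High (Extend_left High High (Extend_right (Extend_left (Extend_right High High (Extend_left High High (Extend_right (Extend_left
    (Extend_right High (Extend_left High High (Extend_left (Kill_left 2) (Kill_left 2) (Kill_left 2) (Extend_right (Extend_right
    (Extend_right Low (Extend_left (Kill_left 5) Low Low Low) (Extend_left High High (Extend_right High High High (Extend_left (Extend_left
    (Kill_left 5) (Kill_left 5) Low Low) High High High)) (Extend_right High (Extend_left (Kill_left 6) High
    High High) (Extend_left Low Low (Extend_right Low Low Low (Extend_right (Kill_right 9) (Kill_right 9) Low Low))
    (Extend_right Low Low (Extend_left (Kill_left 7) (Kill_left 7) (Extend_right (Extend_right Low Low (Extend_left Low (Extend_left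
    (Kill_left 7) (Kill_left 7) Found (Kill_left 10)) (Kill_left 7) (Kill_left 7)) (Kill_right
    11)) Low Low Low) Low) High)) Low)) High) Low Low Low) High High High)) Low) (Extend_left High (Extend_right
    (Kill_right 2) (Kill_right 2) (Kill_right 2) (Extend_left (Extend_left (Extend_left Low (Extend_right (Kill_right 5) Low
    Low Low) (Extend_right High High (Extend_left High High High (Extend_right (Extend_right (Kill_right 5) (Kill_right 5) Low
    Low) High High High)) (Extend_left High (Extend_right (Kill_right 6) High High High) (Extend_right Low Low (Extend_left
    Low Low Low (Extend_left (Kill_left 9) (Kill_left 9) Low Low)) (Extend_left Low Low (Extend_right (Kill_right 7)
    (Kill_right 7) (Extend_left (Extend_left Low Low (Extend_right Low (Extend_right (Kill_right 7) (Kill_right 7) Found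
    (Kill_right 10)) (Kill_right 7) (Kill_right 7)) (Kill_left 11)) Low Low Low) Low) High)) Low))
    High) Low Low Low) High High High)) Low Low) (Kill_right 2)) High High High) High High High)
    (Kill_left 2)) (Kill_right 2)) High High High) High High High) (Extend_left (Kill_left 0) (Kill_left
    0) (Extend_right Low (Extend_right (Extend_right (Extend_left High (Extend_right High (Extend_left (Extend_left High High (Kill_left 0)
    (Kill_left 0)) High High High) (Extend_left (Extend_left (Extend_left Low (Kill_left 0) (Extend_right Low (Extend_right (Extend_right
    Low Low Low (Kill_right 7)) Low Low Low) High High) (Kill_left 5)) Low Low Low) (Extend_right (Extend_left
    High High (Extend_right High High (Extend_left (Extend_right (Extend_right High (Extend_left High High (Extend_right (Extend_left (Extend_left High
    High (Kill_left 6) (Kill_left 6)) High High High) High High High) (Kill_left 6)) (Kill_right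
    6) (Kill_right 6)) High High High) High High High) (Kill_right 6)) (Kill_left 4)) High High
    High) High High) (Kill_right 4)) (Kill_left 0) (Kill_left 0)) High High High) (Extend_left (Extend_right Low
    Low (Extend_left Low Low (Extend_right (Extend_left (Extend_right Low Low (Extend_left Low Low (Extend_left (Kill_left 3) Low Low Low)
    (Kill_left 3)) (Kill_right 5)) Low Low Low) Low Low Low) (Kill_left 3)) (Kill_right 3)) Low
    Low Low) Low Low) High High) (Extend_right Low (Extend_right High High (Extend_left (Kill_left 1) (Kill_left 1) Low
    Low) Low) High High))) (Extend_left High High (Extend_right (Kill_right 0) (Kill_right 0) (Extend_left Low (Extend_left
    (Extend_left (Extend_right High (Extend_left High (Extend_right (Extend_right High High (Kill_right 0) (Kill_right 0)) High High
    High) (Extend_right (Extend_right (Extend_right Low (Kill_right 0) (Extend_left Low (Extend_left (Extend_left Low Low Low (Kill_left 7))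
    Low Low Low) High High) (Kill_right 5)) Low Low Low) (Extend_left (Extend_right High High (Extend_left High High
    (Extend_right (Extend_left (Extend_left High (Extend_right High High (Extend_left (Extend_right (Extend_right High High (Kill_right 6)
    (Kill_right 6)) High High High) High High High) (Kill_right 6)) (Kill_left 6) (Kill_left 6))
    High High High) High High High) (Kill_left 6)) (Kill_right 4)) High High High) High High)
    (Kill_left 4)) (Kill_right 0) (Kill_right 0)) High High High) (Extend_right (Extend_left Low Low (Extend_right Low
    Low (Extend_left (Extend_right (Extend_left Low Low (Extend_right Low Low (Extend_right (Kill_right 3) Low Low Low) (Kill_right
    3)) (Kill_left 5)) Low Low Low) Low Low Low) (Kill_right 3)) (Kill_left 3)) Low Low Low) Low
    Low) High High) (Extend_left Low (Extend_left High High (Extend_right (Kill_right 1) (Kill_right 1) Low Low) Low)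
    High High)) Low)"

definition cert3 :: cert where
  "cert3 =
    Extend_right (Extend_left (Extend_right Low (Extend_left Low Low (Extend_right (Extend_left (Extend_left Low Low (Kill_left 1) (Kill_left 1))
    Low Low Low) Low Low Low) (Kill_left 1)) (Extend_left Low (Extend_left (Extend_right (Extend_right Low Low (Kill_right 1)
    (Kill_right 1)) Low Low Low) Low Low Low) (Extend_right High High (Extend_left High High High (Extend_left
    (Kill_left 2) High High High)) (Extend_left High High (Extend_right (Kill_right 2) High High High) (Extend_right
    Low Low (Extend_left Low Low Low (Extend_left (Kill_left 3) Low Low Low)) (Extend_left Low Low (Extend_right (Kill_right
    3) Low Low Low) High)))) High) (Kill_right 1)) Low Low Low) Low Low Low"

text \<open>The target \<open>[5]\<close> is unattainable: only a letter \<open>4\<close> can be at the centre.\<close>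

lemma check_certs:
  "check [5] [5] 1 Low [] []"
  "check [5] [5] 2 Low [] []"
  "check [5] [5] 3 cert3 [] []"
  "check [3,1,3,1,3,4,4,4,3,2,3] [3,1,3,1,2,1,1,3,3,3] 4 cert4 [] []"
  by code_simp+

lemma window_center: "window a j [] (int (a j)) []"
  by (simp add: window_def)

lemma near_nu_reflect: "near_nu a \<Longrightarrow> near_nu (reflect a)"
proof -
  assume a: "near_nu a"
  then have "\<forall>i. 1 \<le> a i" by (simp add: near_nu_def)
  with a show ?thesis by (simp add: near_nu_def markov_lambda_reflect) (simp add: reflect_def)
qed

text \<open>Reflection preserves the lambda-value at 0, so one orientation of the two found words
  can be chosen.\<close>

lemma near_nu_center:
  assumes a: "near_nu a" and x: "4.52782953840 \<le> markov_lambda a 0"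
  obtains b where "near_nu b" "markov_lambda b 0 = markov_lambda a 0" "b 0 = 4"
    "agrees [3,1,3,1,3,4,4,4,3,2,3] (lft b 0)" "agrees [3,1,3,1,2,1,1,3,3,3] (rgt b 0)"
proof -
  have a4: "\<forall>i. a i \<in> {1..4}" and le: "\<And>i. markov_lambda a i \<le> 4.52782953842"
    using a by (auto simp: near_nu_def)
  have pos: "\<forall>i. 1 \<le> a i" using a4 by simp
  \<comment> \<open>With the target [5] the conclusion of \<open>check_sound\<close> is false, so a
    successful check refutes the central letter.\<close>
  have no5: "\<not> agrees [5] (lft a 0)" "\<not> agrees [5] (rgt a 0)"
    using a4[rule_format, of "-1"] a4[rule_format, of 1] by (auto simp: agrees_def lft_def rgt_def)
  have "int (a 0) \<in> {1, 2, 3, 4}" using a4[rule_format, of 0] by auto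
  moreover have "int (a 0) \<noteq> 1" "int (a 0) \<noteq> 2" "int (a 0) \<noteq> 3"
    using check_sound[OF check_certs(1) _ a4 le x] check_sound[OF check_certs(2) _ a4 le x]
      check_sound[OF check_certs(3) _ a4 le x] window_center[of a 0] no5 by metis+
  ultimately have a0: "int (a 0) = 4" by blast
  have "agrees [3,1,3,1,3,4,4,4,3,2,3] (lft a 0) \<and> agrees [3,1,3,1,2,1,1,3,3,3] (rgt a 0) \<or>
      agrees [3,1,3,1,3,4,4,4,3,2,3] (rgt a 0) \<and> agrees [3,1,3,1,2,1,1,3,3,3] (lft a 0)"
    using check_sound[OF check_certs(4) _ a4 le x] window_center[of a 0] a0 by metis
  then show ?thesis
  proof
    assume "agrees [3,1,3,1,3,4,4,4,3,2,3] (lft a 0) \<and> agrees [3,1,3,1,2,1,1,3,3,3] (rgt a 0)"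
    then show ?thesis using that[of a] a a0 by simp
  next
    assume "agrees [3,1,3,1,3,4,4,4,3,2,3] (rgt a 0) \<and> agrees [3,1,3,1,2,1,1,3,3,3] (lft a 0)"
    then show ?thesis using that[of "reflect a"] near_nu_reflect[OF a] a0 markov_lambda_reflect[OF pos, of 0]
      by (simp add: lft_reflect rgt_reflect) (simp add: reflect_def)
  qed
qed

lemma gap_limit_eq: "\<nu> = 4 + 1 / cfrac left_max + 1 / cfrac right_max"
proof -
  have 1: "shift 1 (ev_periodic [4,3,1,3,1,3] [4,4,4,3,2,3]) = left_max"
    "shift 1 (ev_periodic [0,3,1,3,1,2,1,1,3,3] [3,1,3,1,2,1]) = right_max"
    by (auto simp: max_defs fun_eq_iff)
  then have p: "pos_seq (shift 1 (ev_periodic [4,3,1,3,1,3] [4,4,4,3,2,3]))"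
    "pos_seq (shift 1 (ev_periodic [0,3,1,3,1,2,1,1,3,3] [3,1,3,1,2,1]))"
    using seq4_pos seq4_max by metis+
  show ?thesis unfolding gap_limit_def cfrac_unfold_tail[OF p(1)] cfrac_unfold_tail[OF p(2)] 1
    by (simp add: ev_periodic_def)
qed

text \<open>Otherwise t is a sum of a left and a right deviation, both nonnegative. Either one of
  them alone exceeds t, being beyond its gap, or both are before their gaps and their sum is less
  than t.\<close>

lemma not_in_spectrum:
  assumes "10 \<le> n" "0 < t" "49 / 150964 / (left_den k)\<^sup>2 + right_dist n < t"
    "t < 11 / 754 / (left_den k)\<^sup>2" "t < 1 / cfrac right_max - cf_fun n right_max (outer_edge n)"
    and nu: "\<nu> < 4.52782953842" "4.52782953840 \<le> \<nu> - t"
  shows "\<nu> - t \<notin> markov_spectrum"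
proof
  assume "\<nu> - t \<in> markov_spectrum"
  then obtain a where a: "a \<in> full4" "markov_lambda a 0 = \<nu> - t" "\<And>j. markov_lambda a j \<le> \<nu> - t"
    using markov_spectrum_attained[of "\<nu> - t"] nu assms(2) by auto
  have "markov_lambda a j \<le> 4.52782953842" for j using a(3)[of j] nu assms(2) by linarith
  then have "near_nu a" using a(1) by (simp add: near_nu_def full4_def)
  then obtain b where b: "near_nu b" "markov_lambda b 0 = \<nu> - t" "b 0 = 4"
    "agrees [3,1,3,1,3,4,4,4,3,2,3] (lft b 0)" "agrees [3,1,3,1,2,1,1,3,3,3] (rgt b 0)"
    using near_nu_center[of a] a(2) nu(2) by metis
  have b4: "\<forall>i. b i \<in> {1..4}" and b1: "\<forall>i. 1 \<le> b i" using b(1) by (auto simp: near_nu_def)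
  define l r where "l = lft b 0" and "r = rgt b 0"
  have s4: "seq4 l" "seq4 r" using seq4_sides[OF b4] by (simp_all add: l_def r_def)
  have br: "below right_max r" unfolding r_def by (rule right_below[OF b(1,5)])
  have lr: "l = rgt (reflect b) 0" by (simp add: l_def rgt_reflect)
  note nb = near_nu_reflect[OF b(1)]
  have bl: "below left_max l" using left_below[OF nb, of 0] b(4) by (simp add: lr rgt_reflect)
  have "1 / cfrac l \<le> 1 / cfrac left_max" "1 / cfrac r \<le> 1 / cfrac right_max"
    using below_le seq4_pos seq4_max s4 bl br by blast+
  moreover have "markov_lambda b 0 = 4 + 1 / cfrac l + 1 / cfrac r"
    using markov_lambda_eq[OF b1, of 0] b(3) by (simp add: l_def r_def)
  moreover have "11 / 754 / (left_den k)\<^sup>2 \<le> 1 / cfrac left_max - 1 / cfrac l \<or>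
      1 / cfrac left_max - 1 / cfrac l \<le> 49 / 150964 / (left_den k)\<^sup>2"
    using no_small_after_4[OF nb] by (intro left_gap[OF s4(1) bl]) (simp add: lr)
  moreover have "1 / cfrac r \<le> cf_fun n right_max (outer_edge n) \<or>
      1 / cfrac right_max - right_dist n \<le> 1 / cfrac r"
    using right_gap[OF s4(2) br assms(1)] by (simp add: right_dist_def)
  ultimately show False using b(2) assms(3-5) gap_limit_eq by linarith
qed

section \<open>The sequence attaining the limit\<close>

definition extremal :: "int \<Rightarrow> nat" where
  "extremal j = (if j = 0 then 4 else if j < 0 then left_max (nat (- j - 1)) else right_max (nat (j - 1)))"

lemma extremal_sides: "lft extremal 0 = left_max" "rgt extremal 0 = right_max" "extremal 0 = 4"
  by (auto simp: fun_eq_iff lft_def rgt_def extremal_def)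

lemma extremal_full4: "extremal \<in> full4"
  using seq4_max unfolding full4_def seq4_def extremal_def by auto

lemma markov_lambda_extremal: "markov_lambda extremal 0 = \<nu>"
  using markov_lambda_eq[OF full4_pos[OF extremal_full4], of 0] extremal_sides gap_limit_eq by simp

text \<open>These words are long enough to determine \<open>\<nu>\<close> to the eleven decimals of
  \<open>nu_bounds\<close>.\<close>

lemma window_extremal: "window extremal 0 [3,1,3,1,3,4,4,4,3,2,3,4,4,4,3,2] 4 [3,1,3,1,2,1,1,3,3,3,1,3,1,2,1,3,1,3,1,2]"
  unfolding window_def extremal_sides agrees_def
  by (simp add: all_less_simps max_defs)

lemma nu_bounds: "4.52782953841 < \<nu>" "\<nu> < 4.52782953842"
proof -
  have e: "\<forall>i. extremal i \<in> {1..4}" using extremal_full4 by (simp add: full4_def)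
  have "lam_gt 452782953841 100000000000 [3,1,3,1,3,4,4,4,3,2,3,4,4,4,3,2] 4 [3,1,3,1,2,1,1,3,3,3,1,3,1,2,1,3,1,3,1,2]" by code_simp
  then show "4.52782953841 < \<nu>"
    using lam_gt_sound[OF e window_extremal, of 100000000000 452782953841]
    by (simp add: markov_lambda_extremal)
  have "lam_lt 452782953842 100000000000 [3,1,3,1,3,4,4,4,3,2,3,4,4,4,3,2] 4 [3,1,3,1,2,1,1,3,3,3,1,3,1,2,1,3,1,3,1,2]" by code_simp
  then show "\<nu> < 4.52782953842"
    using lam_lt_sound[OF e window_extremal, of 100000000000 452782953842]
    by (simp add: markov_lambda_extremal)
qed

lemma nu_sound:
  assumes "a \<in> full4" "window a j l c r" "lam_lt 452782953841 100000000000 l c r"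
  shows "markov_lambda a j < \<nu>"
proof -
  have "markov_lambda a j < 452782953841 / 100000000000"
    using lam_lt_sound[OF _ assms(2) _ assms(3)] assms(1) by (simp add: full4_def)
  with nu_bounds(1) show ?thesis by simp
qed

lemma right_near:
  "list_all (\<lambda>i. lam_lt 452782953841 100000000000 (rev (take i [3,1,3,1,2,1,1,3,3,3,1,3,1,2,1,3,1,3,1,2]) @ 4 # [3,1,3,1,3,4]) ([3,1,3,1,2,1,1,3,3,3,1,3,1,2,1,3,1,3,1,2] ! i)
    (drop (Suc i) [3,1,3,1,2,1,1,3,3,3,1,3,1,2,1,3,1,3,1,2])) [0..<14]"
  by code_simp

lemma left_near:
  "list_all (\<lambda>i. lam_lt 452782953841 100000000000 (rev (take i [3,1,3,1,3,4,4,4,3,2,3,4,4,4,3,2]) @ 4 # [3,1,3,1,2,1]) ([3,1,3,1,3,4,4,4,3,2,3,4,4,4,3,2] ! i)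
    (drop (Suc i) [3,1,3,1,3,4,4,4,3,2,3,4,4,4,3,2])) [0..<10]"
  by code_simp

text \<open>The period of \<open>right_max\<close> starts at index 9. From index 14 on the five
  preceding letters are periodic too, so six windows cover all positions; the earlier ones are in
  \<open>right_near\<close>.\<close>

lemma right_far:
  "lam_lt 452782953841 100000000000 [2,1,3,1,3] 1 [3,1,3,1,2]"
  "lam_lt 452782953841 100000000000 [1,2,1,3,1] 3 [1,3,1,2,1]"
  "lam_lt 452782953841 100000000000 [3,1,2,1,3] 1 [3,1,2,1,3]"
  "lam_lt 452782953841 100000000000 [1,3,1,2,1] 3 [1,2,1,3,1]"
  "lam_lt 452782953841 100000000000 [3,1,3,1,2] 1 [2,1,3,1,3]"
  "lam_lt 452782953841 100000000000 [1,3,1,3,1] 2 [1,3,1,3,1]"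
  by (simp_all add: lam_lt_def)

text \<open>Likewise for \<open>left_max\<close>, whose period starts at index 5: from index 10 on
  six windows suffice.\<close>

lemma left_far:
  "lam_lt 452782953841 100000000000 [2,3,4,4,4] 3 [4,4,4,3,2]"
  "lam_lt 452782953841 100000000000 [3,2,3,4,4] 4 [4,4,3,2,3]"
  "lam_lt 452782953841 100000000000 [4,3,2,3,4] 4 [4,3,2,3,4]"
  "lam_lt 452782953841 100000000000 [4,4,3,2,3] 4 [3,2,3,4,4]"
  "lam_lt 452782953841 100000000000 [4,4,4,3,2] 3 [2,3,4,4,4]"
  "lam_lt 452782953841 100000000000 [3,4,4,4,3] 2 [3,4,4,4,3]"
  by (simp_all add: lam_lt_def)

lemma mod_6: "Suc (Suc (6 * k)) mod 6 = 2"
  by presburger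

lemma extremal_right: "markov_lambda extremal (1 + int n) < \<nu>"
proof (cases "n < 14")
  case True
  have "window extremal 0 [3,1,3,1,3,4] 4 [3,1,3,1,2,1,1,3,3,3,1,3,1,2,1,3,1,3,1,2]"
    unfolding window_def extremal_sides agrees_def by (simp add: all_less_simps max_defs)
  from window_right[OF this, of n] True
  have "window extremal (1 + int n) (rev (take n [3,1,3,1,2,1,1,3,3,3,1,3,1,2,1,3,1,3,1,2]) @ 4 # [3,1,3,1,3,4]) ([3,1,3,1,2,1,1,3,3,3,1,3,1,2,1,3,1,3,1,2] ! n) (drop (Suc n) [3,1,3,1,2,1,1,3,3,3,1,3,1,2,1,3,1,3,1,2])"
    by simp
  moreover have "lam_lt 452782953841 100000000000 (rev (take n [3,1,3,1,2,1,1,3,3,3,1,3,1,2,1,3,1,3,1,2]) @ 4 # [3,1,3,1,3,4]) ([3,1,3,1,2,1,1,3,3,3,1,3,1,2,1,3,1,3,1,2] ! n) (drop (Suc n) [3,1,3,1,2,1,1,3,3,3,1,3,1,2,1,3,1,3,1,2])"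
    using right_near True unfolding list_all_iff set_upt by (meson atLeastLessThan_iff zero_le)
  ultimately show ?thesis by (rule nu_sound[OF extremal_full4])
next
  case False
  then obtain k r where n: "n = 14 + 6 * k + r" and r: "r \<in> {0,1,2,3,4,5}"
    using period_cases[of 14 n] by auto
  have w: "window extremal (1 + int n) l c u"
    if "length l \<le> n" "\<forall>i<length l. int (right_max (n - Suc i)) = l ! i" "int (right_max n) = c"
      "\<forall>i<length u. int (right_max (n + Suc i)) = u ! i" for l c u
    using window_rgt[of l n extremal 0 c u] that by (simp add: extremal_sides)
  consider "r = 0" | "r = 1" | "r = 2" | "r = 3" | "r = 4" | "r = 5" using r by blast
  then show ?thesis
  proof cases
    case 1
    show ?thesis by (rule nu_sound[OF extremal_full4 w right_far(1)]) (simp_all add: n 1 all_less_simps max_defs mod_6)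
  next
    case 2
    show ?thesis by (rule nu_sound[OF extremal_full4 w right_far(2)]) (simp_all add: n 2 all_less_simps max_defs mod_6)
  next
    case 3
    show ?thesis by (rule nu_sound[OF extremal_full4 w right_far(3)]) (simp_all add: n 3 all_less_simps max_defs mod_6)
  next
    case 4
    show ?thesis by (rule nu_sound[OF extremal_full4 w right_far(4)]) (simp_all add: n 4 all_less_simps max_defs mod_6)
  next
    case 5
    show ?thesis by (rule nu_sound[OF extremal_full4 w right_far(5)]) (simp_all add: n 5 all_less_simps max_defs mod_6)
  next
    case 6
    show ?thesis by (rule nu_sound[OF extremal_full4 w right_far(6)]) (simp_all add: n 6 all_less_simps max_defs mod_6)
  qed
qed

lemma extremal_left: "markov_lambda extremal (- 1 - int n) < \<nu>"
proof (cases "n < 10")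
  case True
  have "window extremal 0 [3,1,3,1,3,4,4,4,3,2,3,4,4,4,3,2] 4 [3,1,3,1,2,1]"
    unfolding window_def extremal_sides agrees_def by (simp add: all_less_simps max_defs)
  then have "window (reflect extremal) 0 [3,1,3,1,2,1] 4 [3,1,3,1,3,4,4,4,3,2,3,4,4,4,3,2]"
    using window_reflect[of extremal 0] by simp
  from window_right[OF this, of n] True
  have "window (reflect extremal) (1 + int n) (rev (take n [3,1,3,1,3,4,4,4,3,2,3,4,4,4,3,2]) @ 4 # [3,1,3,1,2,1]) ([3,1,3,1,3,4,4,4,3,2,3,4,4,4,3,2] ! n) (drop (Suc n) [3,1,3,1,3,4,4,4,3,2,3,4,4,4,3,2])"
    by simp
  moreover have "lam_lt 452782953841 100000000000 (rev (take n [3,1,3,1,3,4,4,4,3,2,3,4,4,4,3,2]) @ 4 # [3,1,3,1,2,1]) ([3,1,3,1,3,4,4,4,3,2,3,4,4,4,3,2] ! n) (drop (Suc n) [3,1,3,1,3,4,4,4,3,2,3,4,4,4,3,2])"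
    using left_near True unfolding list_all_iff set_upt by (meson atLeastLessThan_iff zero_le)
  moreover have "reflect extremal \<in> full4" using extremal_full4 by (simp add: full4_def reflect_def)
  ultimately have "markov_lambda (reflect extremal) (1 + int n) < \<nu>" using nu_sound by blast
  then show ?thesis using markov_lambda_reflect[OF full4_pos[OF extremal_full4], of "1 + int n"] by simp
next
  case False
  then obtain k r where n: "n = 10 + 6 * k + r" and r: "r \<in> {0,1,2,3,4,5}"
    using period_cases[of 10 n] by auto
  have rf: "reflect extremal \<in> full4" using extremal_full4 by (simp add: full4_def reflect_def)
  have w: "window (reflect extremal) (1 + int n) l c u"
    if "length l \<le> n" "\<forall>i<length l. int (left_max (n - Suc i)) = l ! i" "int (left_max n) = c"
      "\<forall>i<length u. int (left_max (n + Suc i)) = u ! i" for l c u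
    using window_rgt[of l n "reflect extremal" 0 c u] that by (simp add: extremal_sides rgt_reflect)
  consider "r = 0" | "r = 1" | "r = 2" | "r = 3" | "r = 4" | "r = 5" using r by blast
  then have "markov_lambda (reflect extremal) (1 + int n) < \<nu>"
  proof cases
    case 1
    show ?thesis by (rule nu_sound[OF rf w left_far(1)]) (simp_all add: n 1 all_less_simps max_defs mod_6)
  next
    case 2
    show ?thesis by (rule nu_sound[OF rf w left_far(2)]) (simp_all add: n 2 all_less_simps max_defs mod_6)
  next
    case 3
    show ?thesis by (rule nu_sound[OF rf w left_far(3)]) (simp_all add: n 3 all_less_simps max_defs mod_6)
  next
    case 4
    show ?thesis by (rule nu_sound[OF rf w left_far(4)]) (simp_all add: n 4 all_less_simps max_defs mod_6)
  next
    case 5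
    show ?thesis by (rule nu_sound[OF rf w left_far(5)]) (simp_all add: n 5 all_less_simps max_defs mod_6)
  next
    case 6
    show ?thesis by (rule nu_sound[OF rf w left_far(6)]) (simp_all add: n 6 all_less_simps max_defs mod_6)
  qed
  then show ?thesis using markov_lambda_reflect[OF full4_pos[OF extremal_full4], of "1 + int n"] by simp
qed

lemma nu_in_spectrum: "\<nu> \<in> markov_spectrum"
proof -
  have "markov_lambda extremal j \<le> markov_lambda extremal 0" for j
  proof (cases j "0::int" rule: linorder_cases)
    case less
    then show ?thesis using extremal_left[of "nat (- j - 1)"] by (simp add: markov_lambda_extremal)
  next
    case greater
    then show ?thesis using extremal_right[of "nat (j - 1)"] by (simp add: markov_lambda_extremal)
  qed simp
  then show ?thesis
    using markov_supI[of extremal] markov_spectrumI[OF full4_pos[OF extremal_full4]]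
    by (simp add: markov_lambda_extremal)
qed

theorem theorem1p2:
  "(\<exists>\<alpha> \<beta> :: nat \<Rightarrow> real. (\<forall>n. maximal_gap {\<alpha> n<..<\<beta> n}) \<and> \<beta> \<longlonglongrightarrow> \<nu>) \<and>
   4.52782953841 \<le> \<nu> \<and> \<nu> < 4.52782953842"
proof (intro conjI gaps_tendsto nu_in_spectrum)
  show "3 < \<nu>" "\<nu> < 5" "4.52782953841 \<le> \<nu>" "\<nu> < 4.52782953842" using nu_bounds by simp_all
  fix e :: real assume "0 < e"
  \<comment> \<open>Keeping t below 1 / 10^11 leaves \<open>\<nu> - t\<close> above 4.52782953840,
    the lower threshold of the certificates.\<close>
  then obtain k n t where t: "10 \<le> n" "0 < t" "t < min e (1 / 10 ^ 11)"
    "49 / 150964 / (left_den k)\<^sup>2 + right_dist n < t" "t < 11 / 754 / (left_den k)\<^sup>2"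
    "t < 1 / cfrac right_max - cf_fun n right_max (outer_edge n)"
    using ex_common_gap[of "min e (1 / 10 ^ 11)"] by auto
  have "4.52782953840 \<le> \<nu> - t" using t(3) nu_bounds by simp
  then have "\<nu> - t \<notin> markov_spectrum"
    by (rule not_in_spectrum[OF t(1,2,4,5,6) nu_bounds(2)])
  then show "\<exists>x. x \<notin> markov_spectrum \<and> \<nu> - e < x \<and> x < \<nu>"
    using t by (intro exI[of _ "\<nu> - t"]) auto
qed

end
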